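(* For every integer $n\ge 11$, the edge dimension of the generalized Petersen graph $P(n,3)$ is $4$.
   Context: For integers $n\ge 3$ and $1\le k<n/2$, the generalized Petersen graph $P(n,k)$ is the graph with vertex set $\{u_j,v_j : j\in\mathbb{Z}_n\}$ and edge set $\{u_ju_{j+1},\,v_jv_{j+k},\,u_jv_j : j\in\mathbb{Z}_n\}$, indices taken modulo $n$. In a connected graph $G$, the distance between a vertex $x$ and an edge $e=yz$ is $d(x,e)=\min\{d(x,y),d(x,z)\}$, where $d(\cdot,\cdot)$ is the usual graph distance. A set $R$ of vertices is an edge resolving set of $G$ if for every two distinct edges $e,e'$ of $G$ there is $x\in R$ with $d(x,e)\ne d(x,e')$. The edge dimension of $G$ is the minimum cardinality of an edge resolving set of $G$. *)

theory Defs
  imports Main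
begin

text \<open>
  A simple graph is a pair of a vertex set and an edge set; an edge is the two-element
  set of its endpoints.
\<close>

type_synonym 'a graph = "'a set \<times> 'a set set"

definition verts :: "'a graph \<Rightarrow> 'a set" where
  "verts G = fst G"

definition edges :: "'a graph \<Rightarrow> 'a set set" where
  "edges G = snd G"

definition simple_graph :: "'a graph \<Rightarrow> bool" where
  "simple_graph G \<longleftrightarrow>
     (\<forall>e\<in>edges G. \<exists>x\<in>verts G. \<exists>y\<in>verts G. x \<noteq> y \<and> e = {x, y})"

definition adj :: "'a graph \<Rightarrow> ('a \<times> 'a) set" where
  "adj G = {(x, y). {x, y} \<in> edges G}"

definition connected_graph :: "'a graph \<Rightarrow> bool" where
  "connected_graph G \<longleftrightarrow> (\<forall>x\<in>verts G. \<forall>y\<in>verts G. (x, y) \<in> (adj G)\<^sup>*)"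

text \<open>
  \<open>(x, y) \<in> adj G ^^ m\<close> says that there is a walk with \<open>m\<close> edges from \<open>x\<close> to \<open>y\<close>.
  The distance is meaningful only for vertices in the same component; below, connectedness
  of the generalized Petersen graphs is proved.
\<close>

definition gdist :: "'a graph \<Rightarrow> 'a \<Rightarrow> 'a \<Rightarrow> nat" where
  "gdist G x y = (LEAST m. (x, y) \<in> adj G ^^ m)"

definition edist :: "'a graph \<Rightarrow> 'a \<Rightarrow> 'a set \<Rightarrow> nat" where
  "edist G x e = Min (gdist G x ` e)"

definition edge_resolving :: "'a graph \<Rightarrow> 'a set \<Rightarrow> bool" where
  "edge_resolving G R \<longleftrightarrow> R \<subseteq> verts G \<and>
     (\<forall>e\<in>edges G. \<forall>e'\<in>edges G. e \<noteq> e' \<longrightarrow> (\<exists>x\<in>R. edist G x e \<noteq> edist G x e'))"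

definition edge_dim :: "'a graph \<Rightarrow> nat" where
  "edge_dim G = (LEAST m. \<exists>R. edge_resolving G R \<and> finite R \<and> card R = m)"

text \<open>
  \<open>U j\<close> and \<open>V j\<close> are the vertices $u_j$ and $v_j$; the residues modulo \<open>n\<close> are represented
  by the numbers below \<open>n\<close>. The definition is intended for $n \ge 3$ and $1 \le k < n/2$.
\<close>

datatype pvertex = U nat | V nat

definition gen_petersen :: "nat \<Rightarrow> nat \<Rightarrow> pvertex graph" where
  "gen_petersen n k =
     (U ` {..<n} \<union> V ` {..<n},
      {{U j, U ((j + 1) mod n)} | j. j < n} \<union>
      {{V j, V ((j + k) mod n)} | j. j < n} \<union>
      {{U j, V j} | j. j < n})"

lemma edist_doubleton: "edist G x {y, z} = min (gdist G x y) (gdist G x z)"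
  by (simp add: edist_def)

lemma shift_mod_neq:
  fixes j k n :: nat
  assumes "j < n" "0 < k" "k < n"
  shows "j \<noteq> (j + k) mod n"
proof (cases "j + k < n")
  case True
  then show ?thesis using assms by simp
next
  case False
  then have "(j + k) mod n = j + k - n"
    using assms by (simp add: mod_if)
  then show ?thesis using assms False by simp
qed

lemma simple_graph_gen_petersen:
  assumes "n \<ge> 3" "1 \<le> k" "2 * k < n"
  shows "simple_graph (gen_petersen n k)"
  unfolding simple_graph_def
proof
  fix e assume "e \<in> edges (gen_petersen n k)"
  then consider
      j where "j < n" "e = {U j, U ((j + 1) mod n)}"
    | j where "j < n" "e = {V j, V ((j + k) mod n)}"
    | j where "j < n" "e = {U j, V j}"
    unfolding gen_petersen_def edges_def by auto
  then show "\<exists>x\<in>verts (gen_petersen n k). \<exists>y\<in>verts (gen_petersen n k). x \<noteq> y \<and> e = {x, y}"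
  proof cases
    case 1
    then show ?thesis using shift_mod_neq[of j n 1] assms
      by (intro bexI[of _ "U j"] bexI[of _ "U ((j + 1) mod n)"])
         (auto simp: gen_petersen_def verts_def)
  next
    case 2
    then show ?thesis using shift_mod_neq[of j n k] assms
      by (intro bexI[of _ "V j"] bexI[of _ "V ((j + k) mod n)"])
         (auto simp: gen_petersen_def verts_def)
  next
    case 3
    then show ?thesis
      by (intro bexI[of _ "U j"] bexI[of _ "V j"]) (auto simp: gen_petersen_def verts_def)
  qed
qed

lemma connected_gen_petersen: "connected_graph (gen_petersen n k)"
proof -
  let ?R = "adj (gen_petersen n k)"
  have "sym ?R"
    by (auto simp: sym_def adj_def insert_commute)
  then have sym: "sym (?R\<^sup>*)" by (rule sym_rtrancl)
  have U: "(U 0, U j) \<in> ?R\<^sup>*" if "j < n" for j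
    using that
  proof (induction j)
    case (Suc j)
    have "{U j, U (Suc j)} \<in> edges (gen_petersen n k)"
      using Suc.prems by (auto simp: gen_petersen_def edges_def intro!: exI[of _ j])
    then have "(U j, U (Suc j)) \<in> ?R" by (simp add: adj_def)
    with Suc show ?case by (meson Suc_lessD rtrancl.rtrancl_into_rtrancl)
  qed simp
  have "(U j, V j) \<in> ?R" if "j < n" for j
    using that by (auto simp: adj_def gen_petersen_def edges_def)
  with U have V: "(U 0, V j) \<in> ?R\<^sup>*" if "j < n" for j
    using that by (meson rtrancl.rtrancl_into_rtrancl)
  have "(U 0, x) \<in> ?R\<^sup>*" if "x \<in> verts (gen_petersen n k)" for x
    using that U V by (auto simp: gen_petersen_def verts_def)
  then show ?thesis
    unfolding connected_graph_def using sym by (meson rtrancl_trans symD)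
qed

end

(*
  A shortest path in P(n,3) winds around the cycle in one direction, so d(x,y) is the minimum of
  F(t) and F(n-t), where t is the difference of the columns of x and y and F depends only on the
  types (outer or inner) of x and y. Apart from small t, F(t+3) = F(t) + 1. Hence inserting three
  columns on each of two opposite arcs raises the distance between vertices that it separates by
  exactly 1, and keeps the distance between other vertices unless they are nearly antipodal. This
  gives an induction from n to n + 6 for both bounds, starting from finite computations.

  Upper bound: two landmarks lie near column 0 and two near column n div 2. If the distance vectors
  of two edges differ by d(1,1,-1,-1), then the edges are translates of each other by 3d columns
  along one arc, or one of them lies near the landmarks and d has a fixed sign. This statement is
  preserved by the insertion, and for d = 0 it says that the four landmarks resolve all edges.

  Lower bound: given three vertices, rotate one of them to column 4. Then two edges that the three
  vertices do not distinguish can be found in a short list of pairs, each pair lying in columns 0..8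
  or in the nine columns from n div 2 on. A vertex of P(n+6,3) fails to distinguish such a pair
  whenever the corresponding vertex of P(n,3) does.
*)
theory Submission
  imports Defs
begin

section \<open>Distances\<close>

text \<open>A walk of length \<open>m\<close> raises \<open>D\<close> by at most \<open>m\<close>,
  so \<open>D\<close> is a lower bound; following descending edges from the target back to
  \<open>x\<close> yields a walk of length at most \<open>D\<close>.\<close>

lemma gdist_eqI:
  assumes zero: "D x = 0"
    and lip: "\<And>y z. y \<in> verts G \<Longrightarrow> z \<in> verts G \<Longrightarrow> (y, z) \<in> adj G \<Longrightarrow> D z \<le> Suc (D y)"
    and desc: "\<And>z. z \<in> verts G \<Longrightarrow> z \<noteq> x \<Longrightarrow> \<exists>y\<in>verts G. (y, z) \<in> adj G \<and> D y < D z"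
    and closed: "\<And>y z. (y, z) \<in> adj G \<Longrightarrow> y \<in> verts G \<and> z \<in> verts G"
    and y: "x \<in> verts G" "y \<in> verts G"
  shows "gdist G x y = D y"
proof -
  have lower: "D z \<le> m" if "(x, z) \<in> adj G ^^ m" for m z
    using that
  proof (induction m arbitrary: z)
    case 0
    then show ?case using zero by auto
  next
    case (Suc m)
    then obtain w where w: "(x, w) \<in> adj G ^^ m" "(w, z) \<in> adj G" by auto
    then show ?case using Suc.IH[OF w(1)] lip[of w z] closed[of w z] by auto
  qed
  have upper: "\<exists>m\<le>D z. (x, z) \<in> adj G ^^ m" if "z \<in> verts G" for z
    using that
  proof (induction "D z" arbitrary: z rule: less_induct)
    case less
    show ?case
    proof (cases "z = x")
      case True
      then show ?thesis by (intro exI[of _ 0]) auto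
    next
      case False
      then obtain w where w: "w \<in> verts G" "(w, z) \<in> adj G" "D w < D z"
        using desc less.prems by blast
      with less.hyps obtain m where "m \<le> D w" "(x, w) \<in> adj G ^^ m" by blast
      with w show ?thesis by (intro exI[of _ "Suc m"]) auto
    qed
  qed
  obtain m where "m \<le> D y" "(x, y) \<in> adj G ^^ m" using upper y by blast
  moreover from this lower have "m = D y" by force
  ultimately show ?thesis
    unfolding gdist_def using lower by (intro Least_equality) auto
qed

text \<open>
  The cost of covering \<open>t\<close> columns with inner steps (three columns each) and outer steps (one
  column each): \<open>hop\<close> when both types of edges are used, spokes not counted, \<open>vhop\<close> between two
  inner vertices, where any outer step costs two spokes.
\<close>

fun hop :: "nat \<Rightarrow> nat" where
  "hop 0 = 0"
| "hop (Suc 0) = 1"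
| "hop (Suc (Suc 0)) = 2"
| "hop (Suc (Suc (Suc t))) = Suc (hop t)"

fun vhop :: "nat \<Rightarrow> nat" where
  "vhop 0 = 0"
| "vhop (Suc 0) = 3"
| "vhop (Suc (Suc 0)) = 4"
| "vhop (Suc (Suc (Suc t))) = Suc (vhop t)"

text \<open>The spokes are added here: one between vertices of different type. Two outer vertices
  either stay on the outer cycle or use inner edges and pay two spokes.\<close>

fun reach :: "pvertex \<Rightarrow> pvertex \<Rightarrow> nat \<Rightarrow> nat" where
  "reach (U i) (U j) t = min t (Suc (Suc (hop t)))"
| "reach (U i) (V j) t = Suc (hop t)"
| "reach (V i) (U j) t = Suc (hop t)"
| "reach (V i) (V j) t = vhop t"

fun col :: "pvertex \<Rightarrow> nat" where
  "col (U j) = j"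
| "col (V j) = j"

text \<open>One of the two truncated differences is 0, so this is the absolute difference.\<close>

definition gap :: "pvertex \<Rightarrow> pvertex \<Rightarrow> nat" where
  "gap x y = (col x - col y) + (col y - col x)"

definition pdist :: "nat \<Rightarrow> pvertex \<Rightarrow> pvertex \<Rightarrow> nat" where
  "pdist n x y = min (reach x y (gap x y)) (reach x y (n - gap x y))"

lemma hop_eq: "hop t = t div 3 + t mod 3"
  by (induction t rule: hop.induct) auto

lemma vhop_eq: "vhop t = (if t mod 3 = 0 then t div 3 else t div 3 + t mod 3 + 2)"
  by (induction t rule: vhop.induct) auto

lemma verts_gen_petersen: "verts (gen_petersen n k) = U ` {..<n} \<union> V ` {..<n}"
  by (simp add: verts_def gen_petersen_def)

lemma adj_gen_petersen:
  assumes "(y, z) \<in> adj (gen_petersen n k)"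
  obtains j where "j < n" "{y, z} = {U j, U ((j + 1) mod n)}"
    | j where "j < n" "{y, z} = {V j, V ((j + k) mod n)}"
    | j where "j < n" "{y, z} = {U j, V j}"
  using assms by (auto simp: adj_def gen_petersen_def edges_def)

section \<open>Rotations preserve distances\<close>

fun shift :: "nat \<Rightarrow> nat \<Rightarrow> pvertex \<Rightarrow> pvertex" where
  "shift n m (U j) = U ((j + m) mod n)"
| "shift n m (V j) = V ((j + m) mod n)"

lemma shift_adj:
  assumes "(x, y) \<in> adj (gen_petersen n k)"
  shows "(shift n m x, shift n m y) \<in> adj (gen_petersen n k)"
proof -
  have n: "j < n \<Longrightarrow> (j + m) mod n < n" for j by simp
  have c: "((j + i) mod n + m) mod n = ((j + m) mod n + i) mod n" for i j
    by (metis add.commute add.left_commute mod_add_left_eq)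
  show ?thesis using assms
  proof (cases rule: adj_gen_petersen)
    case (1 j)
    then have "{shift n m x, shift n m y} = {U ((j + m) mod n), U (((j + m) mod n + 1) mod n)}"
      using c[of j 1] by (auto simp: doubleton_eq_iff)
    then show ?thesis using n[OF 1(1)] by (auto simp: adj_def edges_def gen_petersen_def)
  next
    case (2 j)
    then have "{shift n m x, shift n m y} = {V ((j + m) mod n), V (((j + m) mod n + k) mod n)}"
      using c[of j k] by (auto simp: doubleton_eq_iff)
    then show ?thesis using n[OF 2(1)] by (auto simp: adj_def edges_def gen_petersen_def)
  next
    case (3 j)
    then have "{shift n m x, shift n m y} = {U ((j + m) mod n), V ((j + m) mod n)}"
      by (auto simp: doubleton_eq_iff)
    then show ?thesis using n[OF 3(1)] by (auto simp: adj_def edges_def gen_petersen_def)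
  qed
qed

lemma shift_shift: "shift n l (shift n m x) = shift n (m + l) x"
  by (cases x) (simp_all add: mod_add_left_eq add.assoc)

lemma shift_verts: "x \<in> verts (gen_petersen n k) \<Longrightarrow> shift n m x \<in> verts (gen_petersen n k)"
  by (auto simp: verts_gen_petersen)

lemma shift_self: "x \<in> verts (gen_petersen n k) \<Longrightarrow> n dvd m \<Longrightarrow> shift n m x = x"
  by (auto simp: verts_gen_petersen)

text \<open>Walks are carried to walks by the rotation, and back by the rotation through
  \<open>n - m\<close>.\<close>

lemma gdist_shift:
  assumes "x \<in> verts (gen_petersen n k)" "y \<in> verts (gen_petersen n k)" "m \<le> n"
  shows "gdist (gen_petersen n k) (shift n m x) (shift n m y) = gdist (gen_petersen n k) x y"
proof -
  let ?A = "adj (gen_petersen n k)"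
  have *: "(shift n l u, shift n l v) \<in> ?A ^^ i" if "(u, v) \<in> ?A ^^ i" for u v l i
    using that by (induction i arbitrary: v) (auto intro: shift_adj relcompI)
  have "(shift n m x, shift n m y) \<in> ?A ^^ i \<longleftrightarrow> (x, y) \<in> ?A ^^ i" for i
    using *[of "shift n m x" "shift n m y" i "n - m"] *[of x y i m] assms
    by (auto simp: shift_shift shift_self)
  then show ?thesis by (simp add: gdist_def)
qed

section \<open>The distance formula along edges\<close>

definition cyc :: "(nat \<Rightarrow> nat) \<Rightarrow> nat \<Rightarrow> nat \<Rightarrow> nat" where
  "cyc F n t = min (F t) (F (n - t))"

lemma pdist_cyc: "pdist n x y = cyc (reach x y) n (gap x y)"
  by (simp add: pdist_def cyc_def)

lemma cyc_sym: "t \<le> n \<Longrightarrow> cyc F n (n - t) = cyc F n t"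
  by (simp add: cyc_def min.commute)

lemma cyc_step1:
  assumes F: "\<And>t. F (Suc t) \<le> Suc (F t)" "\<And>t. F t \<le> Suc (F (Suc t))" and j: "j < n"
  shows "cyc F n ((j + 1) mod n) \<le> Suc (cyc F n j)" "cyc F n j \<le> Suc (cyc F n ((j + 1) mod n))"
proof -
  \<comment> \<open>For \<open>j = n - 1\<close> the step wraps to column 0, where the formula has
    the same value as at \<open>n\<close>.\<close>
  have eq: "cyc F n ((j + 1) mod n) = cyc F n (Suc j)"
    using j cyc_sym[of 0 n F] by (cases "Suc j = n") simp_all
  have s: "n - j = Suc (n - Suc j)" using j by simp
  show "cyc F n ((j + 1) mod n) \<le> Suc (cyc F n j)" "cyc F n j \<le> Suc (cyc F n ((j + 1) mod n))"
    unfolding eq unfolding cyc_def s using F[of j] F[of "n - Suc j"] by linarith+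
qed

text \<open>Only the steps from columns \<open>n - 1\<close> and \<open>n - 2\<close> over column 0
  escape the recursion for \<open>F\<close>. There the conditions on \<open>F\<close> at 1 and 2
  compare the short arcs, and the long arcs have at least 9 columns and so cost at least 3.\<close>

lemma cyc_step3:
  assumes F: "\<And>t. F (Suc (Suc (Suc t))) = Suc (F t)"
    and small: "F (Suc 0) \<le> Suc (F 2)" "F 2 \<le> Suc (F (Suc 0))" "F (Suc 0) \<le> 4" "F 2 \<le> 4"
    and large: "\<And>t. 9 \<le> t \<Longrightarrow> 3 \<le> F t"
    and j: "j < n" "11 \<le> n"
  shows "cyc F n ((j + 3) mod n) \<le> Suc (cyc F n j)" "cyc F n j \<le> Suc (cyc F n ((j + 3) mod n))"
proof -
  have "cyc F n ((j + 3) mod n) \<le> Suc (cyc F n j) \<and> cyc F n j \<le> Suc (cyc F n ((j + 3) mod n))"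
  proof (cases "j + 3 \<le> n")
    case True
    have eq: "cyc F n ((j + 3) mod n) = cyc F n (j + 3)"
      using j True cyc_sym[of 0 n F] by (cases "j + 3 = n") (simp_all add: le_neq_implies_less)
    have "n - j = Suc (Suc (Suc (n - (j + 3))))" using True by simp
    then show ?thesis unfolding eq unfolding cyc_def using F[of j] F[of "n - (j + 3)"]
      by (simp add: numeral_3_eq_3 min_def)
  next
    case False
    then consider "j = n - 1" "(j + 3) mod n = 2" | "j = n - 2" "(j + 3) mod n = 1"
      using j by (cases "j = n - 1") (simp_all add: mod_if)
    then show ?thesis
    proof cases
      case 1
      with j have "cyc F n j = min (F (n - 1)) (F (Suc 0))" "cyc F n ((j + 3) mod n) = min (F 2) (F
          (n - 2))"
        by (simp_all add: cyc_def)
      then show ?thesis using small large[of "n - 1"] large[of "n - 2"] j by linarith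
    next
      case 2
      with j have "cyc F n j = min (F (n - 2)) (F 2)" "cyc F n ((j + 3) mod n) = min (F (Suc 0)) (F
          (n - 1))"
        by (simp_all add: cyc_def)
      then show ?thesis using small large[of "n - 1"] large[of "n - 2"] j by linarith
    qed
  qed
  then show "cyc F n ((j + 3) mod n) \<le> Suc (cyc F n j)" "cyc F n j \<le> Suc (cyc F n ((j + 3) mod n))"
    by auto
qed

lemma hop_Suc: "hop (Suc t) \<le> Suc (hop t)" "hop t \<le> Suc (hop (Suc t))"
  by (induction t rule: hop.induct) auto

lemma vhop_hop: "vhop t \<le> Suc (Suc (hop t))" "hop t \<le> vhop t"
  by (induction t rule: hop.induct) auto

lemma hop_le: "hop t \<le> t"
  by (induction t rule: hop.induct) auto

lemma hop_ge: "9 \<le> t \<Longrightarrow> 3 \<le> hop t"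
  unfolding hop_eq by presburger

lemma vhop_ge: "9 \<le> t \<Longrightarrow> 3 \<le> vhop t"
  using hop_ge[of t] vhop_hop(2)[of t] by linarith

text \<open>With \<open>x\<close> in column 0 the gap is the column of the other vertex, so the
  cyclic step lemmas apply; other sources follow later by rotation.\<close>

lemma pdist_lipschitz:
  assumes n: "11 \<le> n" and x: "x = U 0 \<or> x = V 0" and a: "(y, z) \<in> adj (gen_petersen n 3)"
  shows "pdist n x z \<le> Suc (pdist n x y)"
proof -
  have UU: "min (Suc t) (Suc (Suc (hop (Suc t)))) \<le> Suc (min t (Suc (Suc (hop t))))"
    "min t (Suc (Suc (hop t))) \<le> Suc (min (Suc t) (Suc (Suc (hop (Suc t)))))" for t
    using hop_Suc[of t] by linarith+
  from a show ?thesis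
  proof (cases rule: adj_gen_petersen)
    case (1 j)
    have *: "cyc (reach x (U 0)) n ((j + 1) mod n) \<le> Suc (cyc (reach x (U 0)) n j)"
         "cyc (reach x (U 0)) n j \<le> Suc (cyc (reach x (U 0)) n ((j + 1) mod n))"
      using x cyc_step1[OF _ _ 1(1), of "reach x (U 0)"] UU hop_Suc by auto
    have r: "reach x (U i) = reach x (U 0)" for i using x by auto
    have "pdist n x (U i) = cyc (reach x (U 0)) n i" for i
      using x by (auto simp: pdist_cyc gap_def r[of i])
    with * 1(2) show ?thesis by (auto simp: doubleton_eq_iff)
  next
    case (2 j)
    have h2: "9 \<le> t \<Longrightarrow> Suc (Suc 0) \<le> hop t" for t using hop_ge[of t] by simp
    have *: "cyc (reach x (V 0)) n ((j + 3) mod n) \<le> Suc (cyc (reach x (V 0)) n j)"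
         "cyc (reach x (V 0)) n j \<le> Suc (cyc (reach x (V 0)) n ((j + 3) mod n))"
      using x cyc_step3[OF _ _ _ _ _ _ 2(1) n, of "reach x (V 0)"] h2 vhop_ge
      by (auto simp: numeral_2_eq_2 numeral_3_eq_3 le_SucI)
    have r: "reach x (V i) = reach x (V 0)" for i using x by auto
    have "pdist n x (V i) = cyc (reach x (V 0)) n i" for i
      using x by (auto simp: pdist_cyc gap_def r[of i])
    with * 2(2) show ?thesis by (auto simp: doubleton_eq_iff)
  next
    case (3 j)
    have r: "reach x (U j) t \<le> Suc (reach x (V j) t) \<and> reach x (V j) t \<le> Suc (reach x (U j) t)" for t
      using x vhop_hop[of t] hop_le[of t] by auto
    have g: "gap x (U j) = gap x (V j)" by (simp add: gap_def)
    have "pdist n x (U j) \<le> Suc (pdist n x (V j)) \<and> pdist n x (V j) \<le> Suc (pdist n x (U j))"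
      unfolding pdist_def g using r[of "gap x (V j)"] r[of "n - gap x (V j)"] by (auto simp:
          min_le_iff_disj)
    with 3(2) show ?thesis by (auto simp: doubleton_eq_iff)
  qed
qed

lemma adjI:
  "j < n \<Longrightarrow> (U j, U ((j + 1) mod n)) \<in> adj (gen_petersen n k)"
  "j < n \<Longrightarrow> (U ((j + 1) mod n), U j) \<in> adj (gen_petersen n k)"
  "j < n \<Longrightarrow> (V j, V ((j + k) mod n)) \<in> adj (gen_petersen n k)"
  "j < n \<Longrightarrow> (V ((j + k) mod n), V j) \<in> adj (gen_petersen n k)"
  "j < n \<Longrightarrow> (U j, V j) \<in> adj (gen_petersen n k)"
  "j < n \<Longrightarrow> (V j, U j) \<in> adj (gen_petersen n k)"
  by (auto simp: adj_def edges_def gen_petersen_def insert_commute)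

section \<open>Descent towards the source\<close>

lemma hop_inc: "Suc t mod 3 \<noteq> 0 \<Longrightarrow> hop (Suc t) = Suc (hop t)"
  by (auto simp: hop_eq div_Suc mod_Suc split: if_splits)

lemma vhop_less: "t mod 3 = 0 \<Longrightarrow> vhop t = hop t"
  by (simp add: hop_eq vhop_eq)

text \<open>At a multiple of 3 the inner neighbour is closer; otherwise dropping one column lowers
  \<open>hop\<close> by 1 and with it the whole cost.\<close>

lemma reach_descent_U:
  assumes "x = U 0 \<or> x = V 0" "0 < reach x (U i) t"
  shows "(\<exists>s. t = Suc s \<and> reach x (U i) s < reach x (U i) t) \<or> reach x (V i) t < reach x (U i) t"
proof (cases "t mod 3 = 0")
  case True
  then show ?thesis using assms vhop_less[of t] by (cases t) auto
next
  case False
  then obtain s where s: "t = Suc s" by (cases t) auto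
  then have "reach x (U i) s < reach x (U i) t" using assms(1) False hop_inc[of s] by auto
  with s show ?thesis by blast
qed

text \<open>With three or more columns left an inner step helps; with at most two the spoke leads
  towards the source.\<close>

lemma reach_descent_V:
  assumes "x = U 0 \<or> x = V 0" "0 < reach x (V i) t"
  shows "(\<exists>s. t = s + 3 \<and> reach x (V i) s < reach x (V i) t) \<or> reach x (U i) t < reach x (V i) t"
proof (cases "3 \<le> t")
  case True
  then obtain s where s: "t = s + 3" by (metis le_add_diff_inverse2)
  then have "reach x (V i) s < reach x (V i) t" using assms(1) by (auto simp: numeral_3_eq_3)
  with s show ?thesis by blast
next
  case False
  then have "t = 0 \<or> t = 1 \<or> t = 2" by arith
  then show ?thesis using assms by (auto simp: numeral_2_eq_2)
qed

text \<open>The minimum in \<open>pdist\<close> is attained on one of the two arcs. The descent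
  follows that arc, to lower columns for \<open>b\<close> and to higher ones for
  \<open>n - b\<close>, or takes the spoke.\<close>

lemma pdist_descent:
  assumes n: "11 \<le> n" and x: "x = U 0 \<or> x = V 0" and z: "z \<in> verts (gen_petersen n 3)" "z \<noteq> x"
  shows "\<exists>y\<in>verts (gen_petersen n 3). (y, z) \<in> adj (gen_petersen n 3) \<and> pdist n x y < pdist n x z"
proof -
  define b where "b = col z"
  have b: "b < n" using z by (auto simp: b_def verts_gen_petersen)
  have rU: "reach x (U i) = reach x (U b)" for i using x by auto
  have rV: "reach x (V i) = reach x (V b)" for i using x by auto
  have colx: "col x = 0" using x by auto
  have le: "pdist n x y \<le> reach x y t" if "t = col y \<or> t = n - col y \<or> (col y = 0 \<and> t = n)" for y t
    using that by (auto simp: pdist_def gap_def colx)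
  have p: "pdist n x z = reach x z b \<or> pdist n x z = reach x z (n - b)"
    by (auto simp: pdist_def gap_def colx b_def min_def)
  have pos: "0 < reach x z b" "0 < reach x z (n - b)"
  proof -
    have *: "0 < reach x z t" if "z \<noteq> x" "t = 0 \<Longrightarrow> b = 0" for t
    proof (cases "t = 0")
      case True
      then show ?thesis using that x by (cases z) (auto simp: b_def)
    next
      case False
      have "0 < vhop t" using False by (induction t rule: vhop.induct) auto
      with False show ?thesis using that x by (cases z) auto
    qed
    show "0 < reach x z b" "0 < reach x z (n - b)" using *[of b] *[of "n - b"] z b by auto
  qed
  show ?thesis
  proof (cases z)
    case (U i)
    then have zU: "z = U b" by (simp add: b_def)
    have spoke: ?thesis if "pdist n x z = reach x z t" "reach x (V b) t < reach x (U b) t" "t = b \<or>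
        t = n - b" for t
      using le[of t "V b"] that zU b by (intro bexI[of _ "V b"]) (auto simp: verts_gen_petersen adjI)
    from p show ?thesis
    proof
      assume p: "pdist n x z = reach x z b"
      from reach_descent_U[OF x, of b b] pos zU
      consider s where "b = Suc s" "reach x (U b) s < reach x (U b) b" | "reach x (V b) b < reach x
          (U b) b"
        by auto
      then show ?thesis
      proof cases
        case 1
        have "(U s, z) \<in> adj (gen_petersen n 3)" using adjI(1)[of s n] 1 zU b by simp
        moreover have "pdist n x (U s) < pdist n x z" using le[of s "U s"] rU[of s] 1 p zU by simp
        ultimately show ?thesis using 1 b by (intro bexI[of _ "U s"]) (auto simp: verts_gen_petersen)
      qed (use spoke p in auto)
    next
      assume p: "pdist n x z = reach x z (n - b)"
      from reach_descent_U[OF x, of b "n - b"] pos zU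
      consider s where "n - b = Suc s" "reach x (U b) s < reach x (U b) (n - b)"
        | "reach x (V b) (n - b) < reach x (U b) (n - b)"
        by auto
      then show ?thesis
      proof cases
        case 1
        let ?c = "(b + 1) mod n"
        \<comment> \<open>A neighbour in column 0 has remaining arc 0 and not
          \<open>n\<close>.\<close>
        have "s = n - ?c \<or> (s = 0 \<and> ?c = 0)" using 1 b by (cases "Suc b = n") auto
        then have "pdist n x (U ?c) \<le> reach x (U ?c) s" by (intro le) auto
        then have "pdist n x (U ?c) < pdist n x z" using rU[of ?c] 1 p zU by simp
        moreover have "(U ?c, z) \<in> adj (gen_petersen n 3)" using adjI(2)[of b n] zU b by simp
        ultimately show ?thesis using 1 b by (intro bexI[of _ "U ?c"]) (auto simp: verts_gen_petersen)
      qed (use spoke p in auto)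
    qed
  next
    case (V i)
    then have zV: "z = V b" by (simp add: b_def)
    have spoke: ?thesis if "pdist n x z = reach x z t" "reach x (U b) t < reach x (V b) t" "t = b \<or>
        t = n - b" for t
      using le[of t "U b"] that zV b by (intro bexI[of _ "U b"]) (auto simp: verts_gen_petersen adjI)
    from p show ?thesis
    proof
      assume p: "pdist n x z = reach x z b"
      from reach_descent_V[OF x, of b b] pos zV
      consider s where "b = s + 3" "reach x (V b) s < reach x (V b) b" | "reach x (U b) b < reach x
          (V b) b"
        by auto
      then show ?thesis
      proof cases
        case 1
        have "(V s, z) \<in> adj (gen_petersen n 3)" using adjI(3)[of s n 3] 1 zV b by simp
        moreover have "pdist n x (V s) < pdist n x z" using le[of s "V s"] rV[of s] 1 p zV by simp
        ultimately show ?thesis using 1 b by (intro bexI[of _ "V s"]) (auto simp: verts_gen_petersen)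
      qed (use spoke p in auto)
    next
      assume p: "pdist n x z = reach x z (n - b)"
      from reach_descent_V[OF x, of b "n - b"] pos zV
      consider s where "n - b = s + 3" "reach x (V b) s < reach x (V b) (n - b)"
        | "reach x (U b) (n - b) < reach x (V b) (n - b)"
        by auto
      then show ?thesis
      proof cases
        case 1
        let ?c = "(b + 3) mod n"
        have "s = n - ?c \<or> (s = 0 \<and> ?c = 0)" using 1 b by (cases "b + 3 = n") auto
        then have "pdist n x (V ?c) \<le> reach x (V ?c) s" by (intro le) auto
        then have "pdist n x (V ?c) < pdist n x z" using rV[of ?c] 1 p zV by simp
        moreover have "(V ?c, z) \<in> adj (gen_petersen n 3)" using adjI(4)[of b n 3] zV b by simp
        ultimately show ?thesis using 1 b by (intro bexI[of _ "V ?c"]) (auto simp: verts_gen_petersen)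
      qed (use spoke p in auto)
    qed
  qed
qed

lemma gdist_origin:
  assumes n: "11 \<le> n" and x: "x = U 0 \<or> x = V 0" and y: "y \<in> verts (gen_petersen n 3)"
  shows "gdist (gen_petersen n 3) x y = pdist n x y"
proof (rule gdist_eqI)
  show "pdist n x x = 0" using x by (auto simp: pdist_def gap_def)
  show "x \<in> verts (gen_petersen n 3)" using x n by (auto simp: verts_gen_petersen)
  show "y \<in> verts (gen_petersen n 3)" by (rule y)
  show "pdist n x z \<le> Suc (pdist n x y)" if "(y, z) \<in> adj (gen_petersen n 3)" for y z
    using pdist_lipschitz[OF n x that] .
  show "\<exists>y\<in>verts (gen_petersen n 3). (y, z) \<in> adj (gen_petersen n 3) \<and> pdist n x y < pdist n x z"
    if "z \<in> verts (gen_petersen n 3)" "z \<noteq> x" for z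
    using pdist_descent[OF n x that] .
  show "y \<in> verts (gen_petersen n 3) \<and> z \<in> verts (gen_petersen n 3)"
    if "(y, z) \<in> adj (gen_petersen n 3)" for y z
    using that n by (cases rule: adj_gen_petersen) (auto simp: verts_gen_petersen doubleton_eq_iff)
qed

text \<open>If the rotation carries just one of the two vertices over column 0, the gap turns into
  the complementary arc; \<open>pdist\<close> treats both arcs alike.\<close>

lemma gap_shift:
  assumes "x \<in> verts (gen_petersen n k)" "y \<in> verts (gen_petersen n k)" "m \<le> n"
  shows "gap (shift n m x) (shift n m y) = gap x y \<or> gap (shift n m x) (shift n m y) = n - gap x y"
proof -
  have m: "(j + m) mod n = (if j + m < n then j + m else j + m - n)" if "j < n" for j
    using that assms(3) by (auto simp: mod_if)
  have "gap (shift n m x) (shift n m y) = ((col x + m) mod n - (col y + m) mod n) + ((col y + m)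
      mod n - (col x + m) mod n)"
    by (cases x; cases y) (auto simp: gap_def)
  with m[of "col x"] m[of "col y"] show ?thesis using assms
    by (auto simp: verts_gen_petersen gap_def)
qed

lemma reach_shift: "reach (shift n m x) (shift n m y) = reach x y"
  by (cases x; cases y) auto

lemma gap_le: "x \<in> verts (gen_petersen n k) \<Longrightarrow> y \<in> verts (gen_petersen n k) \<Longrightarrow> gap x y \<le> n"
  by (auto simp: verts_gen_petersen gap_def)

lemma pdist_shift:
  assumes "x \<in> verts (gen_petersen n k)" "y \<in> verts (gen_petersen n k)" "m \<le> n"
  shows "pdist n (shift n m x) (shift n m y) = pdist n x y"
  using gap_shift[OF assms] gap_le[OF assms(1,2)]
  by (auto simp: pdist_cyc reach_shift cyc_sym)

theorem gdist_gen_petersen: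
  assumes n: "11 \<le> n" and "x \<in> verts (gen_petersen n 3)" "y \<in> verts (gen_petersen n 3)"
  shows "gdist (gen_petersen n 3) x y = pdist n x y"
proof -
  \<comment> \<open>This rotation brings \<open>x\<close> to column 0, where the formula is
    known.\<close>
  let ?m = "n - col x"
  have "shift n ?m x = U 0 \<or> shift n ?m x = V 0" using assms by (auto simp: verts_gen_petersen)
  then have "gdist (gen_petersen n 3) (shift n ?m x) (shift n ?m y) = pdist n (shift n ?m x) (shift
      n ?m y)"
    using assms by (intro gdist_origin shift_verts) auto
  then show ?thesis using gdist_shift[OF assms(2,3), of ?m] pdist_shift[OF assms(2,3), of ?m] by simp
qed

section \<open>Edges and rotations\<close>

datatype pedge = Sp nat | Ou nat | In nat

fun idx :: "pedge \<Rightarrow> nat" where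
  "idx (Sp j) = j"
| "idx (Ou j) = j"
| "idx (In j) = j"

text \<open>Agrees with reduction modulo \<open>n\<close> below \<open>2 * n\<close>, but is free of
  division.\<close>

definition wrap :: "nat \<Rightarrow> nat \<Rightarrow> nat" where
  "wrap n j = (if j < n then j else j - n)"

fun ends :: "nat \<Rightarrow> pedge \<Rightarrow> pvertex \<times> pvertex" where
  "ends n (Sp j) = (U j, V j)"
| "ends n (Ou j) = (U j, U (wrap n (Suc j)))"
| "ends n (In j) = (V j, V (wrap n (Suc (Suc (Suc j)))))"

definition eset :: "nat \<Rightarrow> pedge \<Rightarrow> pvertex set" where
  "eset n e = {fst (ends n e), snd (ends n e)}"

definition dist2 :: "nat \<Rightarrow> pvertex \<Rightarrow> pvertex \<times> pvertex \<Rightarrow> nat" where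
  "dist2 n x p = min (pdist n x (fst p)) (pdist n x (snd p))"

abbreviation pe :: "nat \<Rightarrow> pvertex \<Rightarrow> pedge \<Rightarrow> nat" where
  "pe n x e \<equiv> dist2 n x (ends n e)"

lemma wrap_mod: "j < 2 * n \<Longrightarrow> wrap n j = j mod n"
  by (auto simp: wrap_def mod_if)

lemma edges_gen_petersen:
  assumes "3 \<le> n"
  shows "edges (gen_petersen n 3) = eset n ` {e. idx e < n}"
proof -
  have w: "wrap n (Suc j) = (j + 1) mod n" "wrap n (Suc (Suc (Suc j))) = (j + 3) mod n" if "j < n" for j
    using that assms by (simp_all add: wrap_mod numeral_3_eq_3)
  have "e \<in> Sp ` {..<n} \<union> Ou ` {..<n} \<union> In ` {..<n}" if "idx e < n" for e
    using that by (cases e) auto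
  then have "eset n ` {e. idx e < n} = eset n ` (Sp ` {..<n} \<union> Ou ` {..<n} \<union> In ` {..<n})"
    by (intro arg_cong[of _ _ "\<lambda>A. eset n ` A"]) auto
  also have "\<dots> = (eset n \<circ> Sp) ` {..<n} \<union> (eset n \<circ> Ou) ` {..<n} \<union> (eset n \<circ> In) ` {..<n}"
    by (simp add: image_Un image_comp)
  also have "\<dots> = edges (gen_petersen n 3)"
    unfolding gen_petersen_def edges_def by (auto simp: eset_def w image_iff)
  finally show ?thesis ..
qed

text \<open>Type and first column determine the edge from 7 columns on; for \<open>n = 6\<close> the
  inner edges at \<open>j\<close> and \<open>j + 3\<close> would coincide.\<close>

lemma eset_inj:
  assumes "7 \<le> n" "idx e < n" "idx e' < n" "eset n e = eset n e'"
  shows "e = e'"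
  using assms
  by (cases e; cases e') (auto simp: eset_def doubleton_eq_iff wrap_def split: if_splits)

lemma ends_verts:
  assumes "3 \<le> n" "idx e < n"
  shows "fst (ends n e) \<in> verts (gen_petersen n k)" "snd (ends n e) \<in> verts (gen_petersen n k)"
  using assms by (cases e; auto simp: verts_gen_petersen wrap_def)+

lemma edist_eset:
  assumes "11 \<le> n" "x \<in> verts (gen_petersen n 3)" "idx e < n"
  shows "edist (gen_petersen n 3) x (eset n e) = pe n x e"
  using assms ends_verts[of n e 3] by (simp add: eset_def edist_doubleton gdist_gen_petersen dist2_def)

lemma edge_resolving_iff:
  assumes "11 \<le> n" "R \<subseteq> verts (gen_petersen n 3)"
  shows "edge_resolving (gen_petersen n 3) R \<longleftrightarrow>
    (\<forall>e e'. idx e < n \<longrightarrow> idx e' < n \<longrightarrow> (\<forall>x\<in>R. pe n x e = pe n x e') \<longrightarrow> e = e')"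
proof -
  have "edge_resolving (gen_petersen n 3) R \<longleftrightarrow>
    (\<forall>e\<in>{e. idx e < n}. \<forall>e'\<in>{e. idx e < n}. eset n e \<noteq> eset n e' \<longrightarrow> (\<exists>x\<in>R. pe n x e \<noteq> pe n x e'))"
    using assms edist_eset[OF assms(1)]
    by (auto simp: edge_resolving_def edges_gen_petersen subset_iff)
  moreover have "eset n e \<noteq> eset n e' \<longleftrightarrow> e \<noteq> e'" if "idx e < n" "idx e' < n" for e e'
    using eset_inj[of n e e'] assms(1) that by auto
  ultimately show ?thesis by (simp, blast)
qed

definition confused :: "nat \<Rightarrow> pvertex set \<Rightarrow> bool" where
  "confused n X \<longleftrightarrow> (\<exists>e e'. idx e < n \<and> idx e' < n \<and> e \<noteq> e' \<and> (\<forall>x\<in>X. pe n x e = pe n x e'))"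

fun turn :: "nat \<Rightarrow> nat \<Rightarrow> pedge \<Rightarrow> pedge" where
  "turn n m (Sp j) = Sp (wrap n (j + m))"
| "turn n m (Ou j) = Ou (wrap n (j + m))"
| "turn n m (In j) = In (wrap n (j + m))"

lemma idx_turn: "idx (turn n m e) = wrap n (idx e + m)"
  by (cases e) auto

lemma wrap_less: "j < 2 * n \<Longrightarrow> wrap n j < n"
  by (auto simp: wrap_def)

lemma ends_turn:
  assumes "3 \<le> n" "idx e < n" "m \<le> n"
  shows "ends n (turn n m e) = (shift n m (fst (ends n e)), shift n m (snd (ends n e)))"
proof -
  have w: "wrap n (i + (j + m) mod n) = (i + (j + m)) mod n" if "i \<le> n" for i j
  proof -
    have "(j + m) mod n < n" using assms(1) by simp
    with that have "i + (j + m) mod n < 2 * n" by linarith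
    then show ?thesis by (simp add: wrap_mod mod_add_right_eq)
  qed
  have "wrap n (Suc ((j + m) mod n)) = Suc (j + m) mod n"
    "wrap n (Suc (Suc (Suc ((j + m) mod n)))) = Suc (Suc (Suc (j + m))) mod n" for j
    using w[of 1 j] w[of 3 j] assms(1) by (simp_all add: numeral_3_eq_3)
  with assms show ?thesis by (cases e) (simp_all add: wrap_mod mod_Suc_eq mod_add_left_eq)
qed

lemma pe_turn:
  assumes "3 \<le> n" "idx e < n" "m \<le> n" "x \<in> verts (gen_petersen n 3)"
  shows "pe n (shift n m x) (turn n m e) = pe n x e"
  using assms ends_verts[OF assms(1,2), of 3] by (simp add: dist2_def ends_turn pdist_shift)

lemma confused_shift:
  assumes "3 \<le> n" "m \<le> n" "X \<subseteq> verts (gen_petersen n 3)" "confused n X"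
  shows "confused n (shift n m ` X)"
proof -
  obtain e e' where e: "idx e < n" "idx e' < n" "e \<noteq> e'" "\<forall>x\<in>X. pe n x e = pe n x e'"
    using assms(4) by (auto simp: confused_def)
  have w: "wrap n (j + m) = wrap n (j' + m) \<Longrightarrow> j = j'" if "j < n" "j' < n" for j j'
    using that assms(2) by (auto simp: wrap_def split: if_splits)
  have "turn n m e \<noteq> turn n m e'" using e w[of "idx e" "idx e'"] by (cases e; cases e') auto
  moreover have "\<forall>x\<in>X. pe n (shift n m x) (turn n m e) = pe n (shift n m x) (turn n m e')"
    using e assms pe_turn[of n] by (metis subsetD)
  moreover have "idx (turn n m e) < n" "idx (turn n m e') < n"
    using e assms(2) by (auto simp: idx_turn intro: wrap_less)
  ultimately show ?thesis unfolding confused_def by blast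
qed

lemma confused_mono: "confused n Y \<Longrightarrow> X \<subseteq> Y \<Longrightarrow> confused n X"
  unfolding confused_def by blast

lemma confused_unshift:
  assumes "3 \<le> n" "m \<le> n" "X \<subseteq> verts (gen_petersen n 3)" "confused n (shift n m ` X)"
  shows "confused n X"
proof -
  have "shift n (n - m) ` shift n m ` X = X"
    using assms(2,3) by (force simp: image_image shift_shift shift_self[where k = 3])
  then show ?thesis
    using confused_shift[OF assms(1), of "n - m" "shift n m ` X"] assms shift_verts[of _ n 3 m] by auto
qed

text \<open>Enlarging a vertex set never creates confusion, so the lower bound reduces to triples,
  with repetitions allowed.\<close>

lemma edge_dim_eq_4I:
  assumes n: "11 \<le> n"
    and R: "R \<subseteq> verts (gen_petersen n 3)" "card R = 4" "finite R" "\<not> confused n R"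
    and three: "\<And>a b c. a \<in> verts (gen_petersen n 3) \<Longrightarrow> b \<in> verts (gen_petersen n 3) \<Longrightarrow>
      c \<in> verts (gen_petersen n 3) \<Longrightarrow> confused n {a, b, c}"
  shows "edge_dim (gen_petersen n 3) = 4"
  unfolding edge_dim_def
proof (rule Least_equality)
  show "\<exists>R. edge_resolving (gen_petersen n 3) R \<and> finite R \<and> card R = 4"
    using R edge_resolving_iff[OF n R(1)] unfolding confused_def by blast
  fix m assume "\<exists>R. edge_resolving (gen_petersen n 3) R \<and> finite R \<and> card R = m"
  then obtain S where S: "edge_resolving (gen_petersen n 3) S" "finite S" "card S = m" by blast
  have SV: "S \<subseteq> verts (gen_petersen n 3)" using S(1) by (simp add: edge_resolving_def)
  have "\<not> confused n S" using S(1) edge_resolving_iff[OF n SV] unfolding confused_def by blast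
  show "4 \<le> m"
  proof (rule ccontr)
    assume "\<not> 4 \<le> m"
    then have "card S \<le> 3" using S by simp
    have U0: "U 0 \<in> verts (gen_petersen n 3)" using n by (simp add: verts_gen_petersen)
    obtain xs where xs: "set xs = S" "length xs = card S"
      using S(2) by (metis finite_distinct_list distinct_card)
    \<comment> \<open>Padding with \<open>U 0\<close> provides three entries even if
      \<open>S\<close> is smaller.\<close>
    have *: "(xs @ replicate 3 (U 0)) ! i \<in> insert (U 0) S" if "i < 3" for i
      using that xs by (auto simp: nth_append in_set_conv_nth)
    let ?ys = "xs @ replicate 3 (U 0)"
    have "S \<subseteq> {?ys ! 0, ?ys ! 1, ?ys ! 2}"
    proof
      fix x assume "x \<in> S"
      then obtain i where "i < length xs" "xs ! i = x" using xs by (auto simp: in_set_conv_nth)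
      moreover from this have "i = 0 \<or> i = 1 \<or> i = 2" using xs \<open>card S \<le> 3\<close> by auto
      ultimately show "x \<in> {?ys ! 0, ?ys ! 1, ?ys ! 2}" by (auto simp: nth_append)
    qed
    moreover have "confused n {?ys ! 0, ?ys ! 1, ?ys ! 2}"
      using *[of 0] *[of 1] *[of 2] SV U0 by (intro three) auto
    ultimately show False using confused_mono \<open>\<not> confused n S\<close> by blast
  qed
qed

text \<open>If one of the three vertices is inner, it is rotated to \<open>V 4\<close>; otherwise
  all are outer and one becomes \<open>U 4\<close>. Column 4 is the middle of the columns 0..8 that
  hold the near pairs of the induction.\<close>

lemma confused_three:
  assumes n: "11 \<le> n"
    and V: "\<And>y z. y \<in> verts (gen_petersen n 3) \<Longrightarrow> z \<in> verts (gen_petersen n 3) \<Longrightarrow> confused n {V 4, y, z}"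
    and U: "\<And>i j. i < n \<Longrightarrow> j < n \<Longrightarrow> confused n {U 4, U i, U j}"
    and abc: "a \<in> verts (gen_petersen n 3)" "b \<in> verts (gen_petersen n 3)" "c \<in> verts (gen_petersen
        n 3)"
  shows "confused n {a, b, c}"
proof -
  let ?m = "\<lambda>x. wrap n (n + 4 - col x)"
  have m: "?m x \<le> n \<and> shift n (?m x) x = (case x of U _ \<Rightarrow> U 4 | V _ \<Rightarrow> V 4)"
    if "x \<in> verts (gen_petersen n 3)" for x
  proof -
    have "(i + wrap n (n + 4 - i)) mod n = 4" if "i < n" for i
      using that n by (auto simp: wrap_def mod_if)
    with that n show ?thesis by (auto simp: verts_gen_petersen intro!: less_imp_le wrap_less)
  qed
  have "\<exists>m\<le>n. confused n (shift n m ` {a, b, c})"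
  proof (cases "\<exists>x\<in>{a, b, c}. \<exists>i. x = V i")
    case True
    then obtain x y z where x: "{a, b, c} = {x, y, z}" "x \<in> {a, b, c}" "\<exists>i. x = V i"
      by blast
    have v: "x \<in> verts (gen_petersen n 3)" "y \<in> verts (gen_petersen n 3)" "z \<in> verts (gen_petersen n 3)"
      proof -
      have "{x, y, z} \<subseteq> verts (gen_petersen n 3)" unfolding x(1)[symmetric] using abc by simp
      then show "x \<in> verts (gen_petersen n 3)" "y \<in> verts (gen_petersen n 3)" "z \<in> verts
          (gen_petersen n 3)"
        by auto
    qed
    have "shift n (?m x) ` {a, b, c} = {V 4, shift n (?m x) y, shift n (?m x) z}"
      unfolding x(1) using m[OF v(1)] x(3) by auto
    then show ?thesis using m[OF v(1)] V[OF shift_verts[OF v(2)] shift_verts[OF v(3)]] by metis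
  next
    case False
    then obtain i j k where "a = U i" "b = U j" "c = U k" by (metis insertCI pvertex.exhaust)
    moreover from this have "shift n (?m a) ` {a, b, c} = {U 4, shift n (?m a) b, shift n (?m a) c}"
      using m[OF abc(1)] by auto
    ultimately show ?thesis using m[OF abc(1)] U n by (intro exI[of _ "?m a"]) auto
  qed
  then obtain m where "m \<le> n" "confused n (shift n m ` {a, b, c})" by blast
  then show ?thesis using n abc confused_unshift[of n m "{a, b, c}"] by simp
qed

section \<open>Evaluation of the lower bound\<close>

text \<open>The filter guarantees two different edges in each pair, whatever the lists.\<close>

definition candidates ::
    "nat \<Rightarrow> nat \<Rightarrow> (pedge \<times> pedge) list \<Rightarrow> (pedge \<times> pedge) list \<Rightarrow> (pedge \<times> pedge) list \<Rightarrow> (pedge \<times>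
        pedge) list"
  where "candidates n h near far mixed = filter (\<lambda>(e, e'). e \<noteq> e')
     (near @ map (\<lambda>(e, e'). (turn n h e, turn n h e')) far @ map (\<lambda>(e, e'). (e, turn n h e')) mixed)"

text \<open>
  The distances from all vertices of one type to an edge are computed as rotations of a single
  list, on unary numbers: this is what makes the evaluation by rewriting feasible.
\<close>

definition tab :: "pvertex \<Rightarrow> pvertex \<Rightarrow> nat \<Rightarrow> nat list" where
  "tab x y n = map (cyc (reach x y) n) [0..<n]"

definition rot :: "nat \<Rightarrow> 'a list \<Rightarrow> 'a list" where
  "rot m xs = drop m xs @ take m xs"

text \<open>Entry \<open>i\<close> of each list is the distance from column \<open>i\<close> to the
  spoke, outer or inner edge with index 0; the rotations supply the second endpoints, in columns 1
  and 3.\<close>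

definition bases :: "nat \<Rightarrow> pvertex \<Rightarrow> nat list \<times> nat list \<times> nat list" where
  "bases n x = (\<lambda>tU tV. (map2 min tU tV, map2 min tU (rot (n - 1) tU), map2 min tV (rot (n - 3) tV)))
     (tab x (U 0) n) (tab x (V 0) n)"

fun evec :: "nat \<Rightarrow> nat list \<times> nat list \<times> nat list \<Rightarrow> pedge \<Rightarrow> nat list" where
  "evec n (s, t, u) (Sp j) = rot (n - j) s"
| "evec n (s, t, u) (Ou j) = rot (n - j) t"
| "evec n (s, t, u) (In j) = rot (n - j) u"

definition bits :: "nat \<Rightarrow> nat list \<times> nat list \<times> nat list \<Rightarrow> pedge \<times> pedge \<Rightarrow> bool list" where
  "bits n b q = map2 (=) (evec n b (fst q)) (evec n b (snd q))"

definition bitsU :: "nat \<Rightarrow> (pedge \<times> pedge) list \<Rightarrow> bool list list" where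
  "bitsU n = map (bits n (bases n (U 0)))"

definition bitsV :: "nat \<Rightarrow> (pedge \<times> pedge) list \<Rightarrow> bool list list" where
  "bitsV n = map (bits n (bases n (V 0)))"

fun pick :: "bool list \<Rightarrow> 'a list \<Rightarrow> 'a list" where
  "pick (s # ss) (x # xs) = (if s then x # pick ss xs else pick ss xs)"
| "pick _ _ = []"

fun meet :: "bool list \<Rightarrow> bool list \<Rightarrow> bool" where
  "meet (a # as) (b # bs) = (if a \<and> b then True else meet as bs)"
| "meet _ _ = False"

text \<open>Each unordered pair is tested in one order only, and every element also against
  itself.\<close>

fun all_pairs :: "('a \<Rightarrow> 'a \<Rightarrow> bool) \<Rightarrow> 'a list \<Rightarrow> bool" where
  "all_pairs p [] = True"
| "all_pairs p (x # xs) = (list_all (p x) (x # xs) \<and> all_pairs p xs)"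

text \<open>The transpose of a list of lists of length \<open>n\<close>, with \<open>n\<close> empty
  rows for the empty list.\<close>

definition rows :: "nat \<Rightarrow> 'a list list \<Rightarrow> 'a list list" where
  "rows n bs = foldr (map2 (#)) bs (replicate n [])"

text \<open>
  The rows are indexed by vertices; their entries tell which of the pairs of edges not
  distinguished by the vertex in column 4 are not distinguished by the given vertex either.
\<close>

definition coversU :: "nat \<Rightarrow> (pedge \<times> pedge) list \<Rightarrow> bool" where
  "coversU n Q = (let bU = bitsU n Q; sel = map (\<lambda>b. b ! 4) bU
     in all_pairs meet (remdups (rows n (pick sel bU))))"

definition coversV :: "nat \<Rightarrow> (pedge \<times> pedge) list \<Rightarrow> bool" where
  "coversV n Q = (let bU = bitsU n Q; bV = bitsV n Q; sel = map (\<lambda>b. b ! 4) bV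
     in all_pairs meet (remdups (rows n (pick sel bU) @ rows n (pick sel bV))))"

section \<open>Correctness of the evaluation\<close>

lemma length_tab [simp]: "length (tab x y n) = n"
  by (simp add: tab_def)

lemma length_rot [simp]: "length (rot m xs) = length xs"
  by (simp add: rot_def)

text \<open>Rotating by \<open>n - c\<close> moves the origin of the table to column
  \<open>c\<close>; entries before \<open>c\<close> are read on the complementary arc, where
  \<open>cyc\<close> agrees.\<close>

lemma nth_rot_tab:
  assumes "c < n" "i < n"
  shows "rot (n - c) (tab x y n) ! i = cyc (reach x y) n ((i - c) + (c - i))"
proof (cases "i < c")
  case True
  then have "rot (n - c) (tab x y n) ! i = cyc (reach x y) n (n - (c - i))"
    using assms by (simp add: rot_def tab_def nth_append)
  then show ?thesis using True assms cyc_sym[of "c - i" n "reach x y"] by simp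
next
  case False
  then show ?thesis using assms by (simp add: rot_def tab_def nth_append)
qed

lemma reach_fun:
  "reach (U i) (U j) = (\<lambda>t. min t (Suc (Suc (hop t))))"
  "reach (U i) (V j) = (\<lambda>t. Suc (hop t))"
  "reach (V i) (U j) = (\<lambda>t. Suc (hop t))"
  "reach (V i) (V j) = vhop"
  by auto

lemma nth_rot: "m \<le> length xs \<Longrightarrow> j < length xs \<Longrightarrow> rot m xs ! j = xs ! wrap (length xs) (j + m)"
  by (auto simp: rot_def nth_append wrap_def add.commute)

lemma bases_nth:
  assumes x: "x = U \<or> x = V" and i: "i < n" and n: "4 \<le> n"
  shows "fst (bases n (x 0)) ! i = pe n (x i) (Sp 0)"
    "fst (snd (bases n (x 0))) ! i = pe n (x i) (Ou 0)"
    "snd (snd (bases n (x 0))) ! i = pe n (x i) (In 0)"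
proof -
  have t: "rot (n - c) (tab (x 0) (U 0) n) ! i = pdist n (x i) (U c)"
    "rot (n - c) (tab (x 0) (V 0) n) ! i = pdist n (x i) (V c)" if "c < n" for c
    using x i that by (elim disjE; simp add: nth_rot_tab pdist_cyc gap_def reach_fun)+
  have t0: "tab (x 0) (U 0) n ! i = pdist n (x i) (U 0)" "tab (x 0) (V 0) n ! i = pdist n (x i) (V 0)"
    using x i by (elim disjE; simp add: tab_def pdist_cyc gap_def reach_fun)+
  show "fst (bases n (x 0)) ! i = pe n (x i) (Sp 0)"
    "fst (snd (bases n (x 0))) ! i = pe n (x i) (Ou 0)"
    "snd (snd (bases n (x 0))) ! i = pe n (x i) (In 0)"
    using t[of 1] t[of 3] t0 i n by (simp_all add: bases_def dist2_def wrap_def numeral_3_eq_3)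
qed

lemma length_bases:
  "length (fst (bases n x)) = n" "length (fst (snd (bases n x))) = n" "length (snd (snd (bases n
      x))) = n"
  by (simp_all add: bases_def)

text \<open>By rotation invariance, distances to the edge with index \<open>c\<close> are those to
  the edge with index 0, read \<open>n - c\<close> columns further on.\<close>

lemma pe_back:
  assumes x: "x = U \<or> x = V" and i: "i < n" and c: "c < n" and n: "4 \<le> n"
  shows "pe n (x (wrap n (i + (n - c)))) (Sp 0) = pe n (x i) (Sp c)"
    "pe n (x (wrap n (i + (n - c)))) (Ou 0) = pe n (x i) (Ou c)"
    "pe n (x (wrap n (i + (n - c)))) (In 0) = pe n (x i) (In c)"
proof -
  let ?y = "x (wrap n (i + (n - c)))"
  have w: "wrap n (i + (n - c)) < n" "wrap n c = c" using i c by (auto simp: wrap_def)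
  have "(wrap n (i + (n - c)) + c) mod n = i"
    using i c by (auto simp: wrap_def mod_if)
  then have "shift n c ?y = x i" using x by auto
  moreover have "?y \<in> verts (gen_petersen n 3)" using x w by (auto simp: verts_gen_petersen)
  ultimately show "pe n (x (wrap n (i + (n - c)))) (Sp 0) = pe n (x i) (Sp c)"
    "pe n (x (wrap n (i + (n - c)))) (Ou 0) = pe n (x i) (Ou c)"
    "pe n (x (wrap n (i + (n - c)))) (In 0) = pe n (x i) (In c)"
    using pe_turn[of n "Sp 0" c ?y] pe_turn[of n "Ou 0" c ?y] pe_turn[of n "In 0" c ?y] w c n by
        simp_all
qed

lemma evec_bases:
  assumes x: "x = U \<or> x = V" and i: "i < n" and n: "4 \<le> n" and e: "idx e < n"
  shows "evec n (bases n (x 0)) e ! i = pe n (x i) e" "length (evec n (bases n (x 0)) e) = n"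
proof -
  obtain s t u where b: "bases n (x 0) = (s, t, u)" by (cases "bases n (x 0)")
  then have l: "length s = n" "length t = n" "length u = n" using length_bases[of n "x 0"] by auto
  have w: "wrap n (i + (n - idx e)) < n" using i e by (auto simp: wrap_def)
  show "evec n (bases n (x 0)) e ! i = pe n (x i) e" "length (evec n (bases n (x 0)) e) = n"
    using bases_nth[OF x w n] pe_back[OF x i e n] i l unfolding b by (cases e; simp add: nth_rot)+
qed

lemma bits:
  assumes "4 \<le> n" "idx (fst q) < n" "idx (snd q) < n" "i < n"
  shows "bits n (bases n (U 0)) q ! i \<longleftrightarrow> pe n (U i) (fst q) = pe n (U i) (snd q)"
    "bits n (bases n (V 0)) q ! i \<longleftrightarrow> pe n (V i) (fst q) = pe n (V i) (snd q)"
    "length (bits n (bases n (U 0)) q) = n"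
    "length (bits n (bases n (V 0)) q) = n"
  using evec_bases[of U i n] evec_bases[of V i n] assms by (simp_all add: bits_def)

lemma rows:
  assumes "\<And>b. b \<in> set bs \<Longrightarrow> length b = n"
  shows "length (rows n bs) = n" "i < n \<Longrightarrow> rows n bs ! i = map (\<lambda>b. b ! i) bs"
  using assms by (induction bs) (simp_all add: rows_def)

lemma pick_map: "pick sel (map f xs) = map f (pick sel xs)"
  by (induction sel xs rule: pick.induct) auto

lemma pick_filter: "pick (map P xs) xs = filter P xs"
  by (induction xs) auto

lemma meet: "meet (map f xs) (map g xs) \<longleftrightarrow> (\<exists>x\<in>set xs. f x \<and> g x)"
  by (induction xs) auto

lemma meet_commute: "meet as bs = meet bs as"
  by (induction as bs rule: meet.induct) auto

lemma all_pairs: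
  assumes "all_pairs p xs" "x \<in> set xs" "y \<in> set xs"
  shows "p x y \<or> p y x"
  using assms by (induction xs) (auto simp: list_all_iff)

definition valid :: "nat \<Rightarrow> (pedge \<times> pedge) list \<Rightarrow> bool" where
  "valid n Q \<longleftrightarrow> list_all (\<lambda>(e, e'). idx e < n \<and> idx e' < n) Q"

definition same :: "nat \<Rightarrow> pedge \<times> pedge \<Rightarrow> pvertex \<Rightarrow> bool" where
  "same n q x \<longleftrightarrow> pe n x (fst q) = pe n x (snd q)"

lemma rows_bits:
  assumes n: "4 \<le> n" and Q: "valid n Q" and i: "i < n"
  shows "map (\<lambda>q. same n q (U i)) Q \<in> set (rows n (bitsU n Q))"
    "map (\<lambda>q. same n q (V i)) Q \<in> set (rows n (bitsV n Q))"
proof -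
  have q: "idx (fst q) < n" "idx (snd q) < n" if "q \<in> set Q" for q
    using that Q by (auto simp: valid_def list_all_iff)
  have lU: "b \<in> set (bitsU n Q) \<Longrightarrow> length b = n" and lV: "b \<in> set (bitsV n Q) \<Longrightarrow> length b = n" for b
    using bits[OF n q i] by (auto simp: bitsU_def bitsV_def)
  have "rows n (bitsU n Q) ! i = map (\<lambda>q. same n q (U i)) Q"
    using rows(2)[of "bitsU n Q" n i, OF lU i] bits[OF n q i] by (simp add: bitsU_def same_def)
  then show "map (\<lambda>q. same n q (U i)) Q \<in> set (rows n (bitsU n Q))"
    using rows(1)[of "bitsU n Q" n, OF lU] i nth_mem by metis
  have "rows n (bitsV n Q) ! i = map (\<lambda>q. same n q (V i)) Q"
    using rows(2)[of "bitsV n Q" n i, OF lV i] bits[OF n q i] by (simp add: bitsV_def same_def)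
  then show "map (\<lambda>q. same n q (V i)) Q \<in> set (rows n (bitsV n Q))"
    using rows(1)[of "bitsV n Q" n, OF lV] i nth_mem by metis
qed

text \<open>Only the pairs that \<open>V 4\<close> fails to distinguish are kept. Any two rows have
  a common true entry, hence a pair that neither vertex distinguishes.\<close>

lemma coversV:
  assumes n: "5 \<le> n" and Q: "valid n Q" and c: "coversV n Q"
    and y: "y \<in> verts (gen_petersen n 3)" and z: "z \<in> verts (gen_petersen n 3)"
  shows "\<exists>q\<in>set Q. same n q (V 4) \<and> same n q y \<and> same n q z"
proof -
  define Q' where "Q' = filter (\<lambda>q. same n q (V 4)) Q"
  have q: "idx (fst q) < n" "idx (snd q) < n" if "q \<in> set Q" for q
    using that Q by (auto simp: valid_def list_all_iff)
  have sel: "map (\<lambda>b. b ! 4) (bitsV n Q) = map (\<lambda>q. same n q (V 4)) Q"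
    using bits(2)[OF _ q] n by (simp add: bitsV_def same_def)
  have v: "valid n Q'" using Q by (auto simp: valid_def list_all_iff Q'_def)
  have p: "pick (map (\<lambda>q. same n q (V 4)) Q) (bitsV n Q) = bitsV n Q'"
    "pick (map (\<lambda>q. same n q (V 4)) Q) (bitsU n Q) = bitsU n Q'"
    by (simp_all add: bitsU_def bitsV_def pick_map pick_filter Q'_def)
  have pw: "all_pairs meet (remdups (rows n (bitsU n Q') @ rows n (bitsV n Q')))"
    using c by (simp add: coversV_def Let_def sel p)
  have m: "map (\<lambda>q. same n q w) Q' \<in> set (remdups (rows n (bitsU n Q') @ rows n (bitsV n Q')))"
    if "w \<in> verts (gen_petersen n 3)" for w
    using rows_bits[OF _ v] that n by (auto simp: verts_gen_petersen)
  have "meet (map (\<lambda>q. same n q y) Q') (map (\<lambda>q. same n q z) Q')"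
    using all_pairs[OF pw m[OF y] m[OF z]] meet_commute by blast
  then show ?thesis by (auto simp: meet Q'_def)
qed

lemma coversU:
  assumes n: "5 \<le> n" and Q: "valid n Q" and c: "coversU n Q" and i: "i < n" and j: "j < n"
  shows "\<exists>q\<in>set Q. same n q (U 4) \<and> same n q (U i) \<and> same n q (U j)"
proof -
  define Q' where "Q' = filter (\<lambda>q. same n q (U 4)) Q"
  have q: "idx (fst q) < n" "idx (snd q) < n" if "q \<in> set Q" for q
    using that Q by (auto simp: valid_def list_all_iff)
  have sel: "map (\<lambda>b. b ! 4) (bitsU n Q) = map (\<lambda>q. same n q (U 4)) Q"
    using bits(1)[OF _ q] n by (simp add: bitsU_def same_def)
  have v: "valid n Q'" using Q by (auto simp: valid_def list_all_iff Q'_def)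
  have p: "pick (map (\<lambda>q. same n q (U 4)) Q) (bitsU n Q) = bitsU n Q'"
    by (simp add: bitsU_def pick_map pick_filter Q'_def)
  have pw: "all_pairs meet (remdups (rows n (bitsU n Q')))"
    using c by (simp add: coversU_def Let_def sel p)
  have m: "map (\<lambda>q. same n q (U w)) Q' \<in> set (remdups (rows n (bitsU n Q')))" if "w < n" for w
    using rows_bits[OF _ v that] n by auto
  have "meet (map (\<lambda>q. same n q (U i)) Q') (map (\<lambda>q. same n q (U j)) Q')"
    using all_pairs[OF pw m[OF i] m[OF j]] meet_commute by blast
  then show ?thesis by (auto simp: meet Q'_def)
qed

section \<open>Inserting six columns\<close>

text \<open>The remainder modulo 3 spoils monotonicity over short distances. The difference 8 is
  forced by \<open>vhop\<close>: \<open>vhop (3 * a + 2) = a + 4\<close>, but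
  \<open>vhop (3 * a + 9) = a + 3\<close>.\<close>

lemma reach_mono:
  assumes "t + 8 \<le> s"
  shows "reach x y t \<le> reach x y s"
proof -
  define a b where ab: "a = t div 3" "b = s div 3"
  define p q where pq: "p = t mod 3" "q = s mod 3"
  have eq: "3 * a + p = t" "3 * b + q = s" and lt: "p = 0 \<or> p = 1 \<or> p = 2" "q = 0 \<or> q = 1 \<or> q = 2"
    by (auto simp: ab pq)
  have hop: "hop t \<le> hop s"
    using assms eq lt unfolding hop_eq ab[symmetric] pq[symmetric] by arith
  have vhop: "vhop t \<le> vhop s"
    using lt assms eq unfolding vhop_eq ab[symmetric] pq[symmetric] by (elim disjE; simp; linarith?)
  from hop vhop assms show ?thesis by (cases x; cases y) auto
qed

text \<open>From 3 columns on, \<open>hop t + 2\<close> is at most \<open>t\<close>, so the minimum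
  for two outer vertices is attained by the route over inner edges.\<close>

lemma reach_add3:
  assumes "3 \<le> t"
  shows "reach x y (t + 3) = Suc (reach x y t)"
proof -
  have "Suc (Suc (hop t)) \<le> t" using assms
    by (induction t rule: hop.induct) (auto simp: le_Suc_eq numeral_eq_Suc)
  then show ?thesis by (cases x; cases y) (auto simp: numeral_3_eq_3)
qed

text \<open>Both arcs gain three columns, so both terms of the minimum grow by 1.\<close>

lemma pdist_far:
  assumes "reach x' y' = reach x y" "gap x' y' = gap x y + 3" "3 \<le> gap x y" "gap x y + 3 \<le> n"
  shows "pdist (n + 6) x' y' = Suc (pdist n x y)"
proof -
  have "n + 6 - (gap x y + 3) = (n - gap x y) + 3" using assms by simp
  then show ?thesis using assms reach_add3[of "gap x y" x y] reach_add3[of "n - gap x y" x y]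
    unfolding pdist_def by (metis add_le_imp_le_diff add.commute min_Suc_Suc)
qed

text \<open>Both insertions lie on the other arc, which is at least 8 columns longer and so never
  becomes the cheaper one.\<close>

lemma pdist_near:
  assumes "reach x' y' = reach x y" "gap x' y' = gap x y" "2 * gap x y + 8 \<le> n"
  shows "pdist (n + 6) x' y' = pdist n x y"
  using assms reach_mono[of "gap x y" "n - gap x y" x y] reach_mono[of "gap x y" "n + 6 - gap x y" x y]
  unfolding pdist_def by simp

text \<open>Both insertions fall into the gap; the complementary arc realizes the distance and is
  unchanged.\<close>

lemma pdist_wrap:
  assumes "reach x' y' = reach x y" "gap x' y' = gap x y + 6" "n + 8 \<le> 2 * gap x y" "gap x y \<le> n"
  shows "pdist (n + 6) x' y' = pdist n x y"
proof -
  let ?t = "n - gap x y"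
  have "n + 6 - (gap x y + 6) = ?t" using assms by simp
  then show ?thesis using assms reach_mono[of ?t "gap x y" x y] reach_mono[of ?t "gap x y + 6" x y]
    unfolding pdist_def by simp
qed

fun recol :: "(nat \<Rightarrow> nat) \<Rightarrow> pvertex \<Rightarrow> pvertex" where
  "recol f (U c) = U (f c)"
| "recol f (V c) = V (f c)"

lemma col_recol: "col (recol f x) = f (col x)"
  by (cases x) auto

lemma reach_recol: "reach (recol f x) (recol g y) = reach x y"
  by (cases x; cases y) (auto simp: reach_fun)

text \<open>
  The correspondence between the columns of \<open>P(n + 6, 3)\<close> and \<open>P(n, 3)\<close> under an insertion at \<open>a\<close>
  and \<open>b\<close>. It is not injective: within a long arc, columns three apart behave alike.
\<close>

definition squeeze :: "nat \<Rightarrow> nat \<Rightarrow> nat \<Rightarrow> nat" where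
  "squeeze a b c = (if c < a then c else if c < b + 3 then c - 3 else c - 6)"

text \<open>A vertex \<open>x\<close> between the insertions is separated from columns 0..8, any
  other \<open>x\<close> from their translates. The bound 38 is \<open>2 * 15 + 8\<close>, which
  \<open>pdist_near\<close> demands for gaps of 15 such as from \<open>h\<close> to
  \<open>h + 15\<close>.\<close>

lemma pdist_squeeze:
  fixes n h y :: _
  assumes n: "38 \<le> n" and h: "h = n div 2" and x: "col x < n + 6" and c: "col y \<le> 8"
  defines "x' \<equiv> recol (squeeze 15 (h + 16)) x"
  shows "pdist (n + 6) x y = pdist n x' y + (if 15 \<le> col x \<and> col x < h + 19 then 1 else 0)"
    "pdist (n + 6) x (recol ((+) (h + 3)) y) = pdist n x' (recol ((+) h) y) +
      (if 15 \<le> col x \<and> col x < h + 19 then 0 else 1)"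
proof -
  have x0: "x = recol (\<lambda>c. c) x" and y0: "y = recol (\<lambda>c. c) y" by (cases x; simp) (cases y; simp)
  have r: "reach x y = reach x' y" "reach x (recol ((+) (h + 3)) y) = reach x' (recol ((+) h) y)"
    unfolding x'_def by (metis reach_recol x0 y0)+
  have h2: "2 * h \<le> n" "n \<le> 2 * h + 1" using h by auto
  note g = gap_def x'_def col_recol squeeze_def
  consider "col x < 15" | "15 \<le> col x" "col x < h + 19" | "h + 19 \<le> col x" by linarith
  note cases = this
  show "pdist (n + 6) x y = pdist n x' y + (if 15 \<le> col x \<and> col x < h + 19 then 1 else 0)"
    using cases
  proof cases
    case 1
    then have "pdist (n + 6) x y = pdist n x' y"
      using n c by (intro pdist_near r) (simp_all add: g)
    with 1 show ?thesis by simp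
  next
    case 2
    then have "pdist (n + 6) x y = Suc (pdist n x' y)"
      using n c h2 by (intro pdist_far r) (simp_all add: g)
    with 2 show ?thesis by simp
  next
    case 3
    then have "pdist (n + 6) x y = pdist n x' y"
      using n c h2 x by (intro pdist_wrap r) (simp_all add: g)
    with 3 show ?thesis by simp
  qed
  show "pdist (n + 6) x (recol ((+) (h + 3)) y) = pdist n x' (recol ((+) h) y) +
      (if 15 \<le> col x \<and> col x < h + 19 then 0 else 1)"
    using cases
  proof cases
    case 1
    then have "pdist (n + 6) x (recol ((+) (h + 3)) y) = Suc (pdist n x' (recol ((+) h) y))"
      using n c h2 by (intro pdist_far r) (simp_all add: g)
    with 1 show ?thesis by simp
  next
    case 2
    then have "pdist (n + 6) x (recol ((+) (h + 3)) y) = pdist n x' (recol ((+) h) y)"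
      using n c h2 by (intro pdist_near r) (auto simp: g)
    with 2 show ?thesis by simp
  next
    case 3
    then have "pdist (n + 6) x (recol ((+) (h + 3)) y) = Suc (pdist n x' (recol ((+) h) y))"
      using n c h2 x by (intro pdist_far r) (simp_all add: g)
    with 3 show ?thesis by simp
  qed
qed


text \<open>The last column that the edge touches, as long as it does not wrap.\<close>

fun hi :: "pedge \<Rightarrow> nat" where
  "hi (Sp j) = j"
| "hi (Ou j) = Suc j"
| "hi (In j) = j + 3"

lemma ends_near:
  assumes "hi e \<le> 8" "38 \<le> n"
  shows "ends (n + 6) e = ends n e" "col (fst (ends n e)) \<le> 8" "col (snd (ends n e)) \<le> 8"
  using assms by (cases e; simp add: wrap_def)+

lemma ends_far:
  assumes "hi e \<le> 8" "38 \<le> n" "h = n div 2"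
  shows "ends n (turn n h e) = (recol ((+) h) (fst (ends n e)), recol ((+) h) (snd (ends n e)))"
proof -
  have "h + 8 < n" using assms by linarith
  with assms(1,2) show ?thesis by (cases e) (simp_all add: wrap_def add.commute)
qed

text \<open>Both endpoints of an edge get the same increment, which therefore passes through the
  minimum.\<close>

lemma pe_squeeze:
  assumes n: "38 \<le> n" and h: "h = n div 2" and x: "col x < n + 6" and e: "hi e \<le> 8"
  shows "pe (n + 6) x e = pe n (recol (squeeze 15 (h + 16)) x) e + (if 15 \<le> col x \<and> col x < h + 19
      then 1 else 0)"
    "pe (n + 6) x (turn (n + 6) (h + 3) e) = pe n (recol (squeeze 15 (h + 16)) x) (turn n h e) +
      (if 15 \<le> col x \<and> col x < h + 19 then 0 else 1)"
proof -
  note p = pdist_squeeze[OF n h x ends_near(2)[OF e n]] pdist_squeeze[OF n h x ends_near(3)[OF e n]]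
  have h3: "h + 3 = (n + 6) div 2" using h by simp
  show "pe (n + 6) x e = pe n (recol (squeeze 15 (h + 16)) x) e + (if 15 \<le> col x \<and> col x < h + 19
      then 1 else 0)"
    using p by (simp add: dist2_def ends_near(1)[OF e n])
  show "pe (n + 6) x (turn (n + 6) (h + 3) e) = pe n (recol (squeeze 15 (h + 16)) x) (turn n h e) +
      (if 15 \<le> col x \<and> col x < h + 19 then 0 else 1)"
    using p n by (simp add: dist2_def ends_far[OF e n h] ends_far[OF e _ h3] ends_near(1)[OF e n])
qed

section \<open>Transfer of undistinguished pairs from \<open>n\<close> to
  \<open>n + 6\<close>\<close>

definition narrow :: "(pedge \<times> pedge) list \<Rightarrow> bool" where
  "narrow Q \<longleftrightarrow> list_all (\<lambda>(e, e'). hi e \<le> 8 \<and> hi e' \<le> 8) Q"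

definition covered :: "(pvertex \<Rightarrow> bool) \<Rightarrow> pvertex \<Rightarrow> (nat \<Rightarrow> (pedge \<times> pedge) list) \<Rightarrow> nat \<Rightarrow> bool" where
  "covered T x Q n \<longleftrightarrow> (\<forall>y\<in>verts (gen_petersen n 3). \<forall>z\<in>verts (gen_petersen n 3). T y \<longrightarrow> T z \<longrightarrow>
     (\<exists>q\<in>set (Q n). same n q x \<and> same n q y \<and> same n q z))"

text \<open>The two edges of a near or of a far pair get equal increments, so equal distances stay
  equal. The edges of a mixed pair would get different ones, hence the empty third list.\<close>

lemma covered_step:
  assumes n: "38 \<le> n" and Q: "narrow near" "narrow far" and T: "\<And>f v. T (recol f v) = T v" and x:
      "col x = 4"
    and c: "covered T x (\<lambda>n. candidates n (n div 2) near far []) n"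
  shows "covered T x (\<lambda>n. candidates n (n div 2) near far []) (n + 6)"
  unfolding covered_def
proof (intro ballI impI)
  define h where "h = n div 2"
  have h3: "(n + 6) div 2 = h + 3" by (simp add: h_def)
  let ?k = "recol (squeeze 15 (h + 16))"
  fix y z assume yz: "y \<in> verts (gen_petersen (n + 6) 3)" "z \<in> verts (gen_petersen (n + 6) 3)" "T
      y" "T z"
  have k: "?k v \<in> verts (gen_petersen n 3)" if "v \<in> verts (gen_petersen (n + 6) 3)" for v
    using that n by (auto simp: verts_gen_petersen squeeze_def h_def)
  have kx: "?k x = x" using x by (cases x) (auto simp: squeeze_def)
  have col: "col v < n + 6" if "v \<in> verts (gen_petersen (n + 6) 3)" for v
    using that by (auto simp: verts_gen_petersen)
  obtain q where q: "q \<in> set (candidates n h near far [])" "same n q x" "same n q (?k y)" "same n q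
      (?k z)"
    using c yz k T unfolding covered_def h_def by blast
  have "\<exists>q'\<in>set (candidates (n + 6) (h + 3) near far []). \<forall>v. col v < n + 6 \<longrightarrow> same n q (?k v) \<longrightarrow>
      same (n + 6) q' v"
  proof -
    from q(1) consider "q \<in> set near" "fst q \<noteq> snd q"
      | e e' where "(e, e') \<in> set far" "q = (turn n h e, turn n h e')" "e \<noteq> e'"
      by (auto simp: candidates_def)
    then show ?thesis
    proof cases
      case 1
      then have "hi (fst q) \<le> 8" "hi (snd q) \<le> 8" using Q(1) by (auto simp: narrow_def list_all_iff)
      then have "same (n + 6) q v" if "col v < n + 6" "same n q (?k v)" for v
        using that pe_squeeze(1)[OF n h_def] by (simp add: same_def)
      with 1 show ?thesis by (intro bexI[of _ q]) (auto simp: candidates_def)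
    next
      case 2
      let ?q = "(turn (n + 6) (h + 3) e, turn (n + 6) (h + 3) e')"
      have hi: "hi e \<le> 8" "hi e' \<le> 8" using 2 Q(2) by (auto simp: narrow_def list_all_iff)
      then have "same (n + 6) ?q v" if "col v < n + 6" "same n q (?k v)" for v
        using that 2 pe_squeeze(2)[OF n h_def] by (simp add: same_def)
      \<comment> \<open>No index wraps, so the translated edges remain different.\<close>
      moreover have "idx e + (h + 3) < n + 6" "idx e' + (h + 3) < n + 6"
        using hi n unfolding h_def by (cases e; cases e'; simp; linarith)+
      then have "turn (n + 6) (h + 3) e \<noteq> turn (n + 6) (h + 3) e'"
        using 2(3) by (cases e; cases e') (auto simp: wrap_def)
      ultimately show ?thesis using 2 by (intro bexI[of _ ?q]) (auto simp: candidates_def)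
    qed
  qed
  then obtain q' where q': "q' \<in> set (candidates (n + 6) (h + 3) near far [])"
    "\<And>v. col v < n + 6 \<Longrightarrow> same n q (?k v) \<Longrightarrow> same (n + 6) q' v"
    by blast
  have "same (n + 6) q' x" using q'(2)[of x] q(2) kx x n by simp
  moreover have "same (n + 6) q' y" "same (n + 6) q' z" using q'(2) q(3,4) col yz by blast+
  ultimately show "\<exists>q\<in>set (candidates (n + 6) ((n + 6) div 2) near far []).
      same (n + 6) q x \<and> same (n + 6) q y \<and> same (n + 6) q z"
    unfolding h3 using q'(1) by blast
qed

lemma nat_induct_step_6:
  assumes "\<And>n. n \<in> {m..<m + 6} \<Longrightarrow> P n" "\<And>n. m \<le> n \<Longrightarrow> P n \<Longrightarrow> P (n + 6)" "m \<le> (n::nat)"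
  shows "P n"
  using assms(3)
proof (induction n rule: less_induct)
  case (less n)
  show ?case
  proof (cases "n < m + 6")
    case False
    then have "P (n - 6 + 6)" using less by (intro assms(2)) auto
    then show ?thesis using False by simp
  qed (use less assms(1) in auto)
qed

section \<open>The upper bound\<close>

definition wU :: "nat \<Rightarrow> pvertex \<Rightarrow> nat list" where
  "wU n x = rot (n - col x) (tab x (U 0) n)"

definition wV :: "nat \<Rightarrow> pvertex \<Rightarrow> nat list" where
  "wV n x = rot (n - col x) (tab x (V 0) n)"

definition pedges :: "nat \<Rightarrow> pedge list" where
  "pedges n = map Sp [0..<n] @ map Ou [0..<n] @ map In [0..<n]"

text \<open>One block per edge type, in the order of \<open>pedges\<close>; rotating by 1 and 3
  brings in the second endpoints.\<close>

definition table :: "nat \<Rightarrow> pvertex list \<Rightarrow> nat list list" where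
  "table n L =
     rows n (map (\<lambda>x. map2 min (wU n x) (wV n x)) L) @
     rows n (map (\<lambda>x. (\<lambda>w. map2 min w (rot 1 w)) (wU n x)) L) @
     rows n (map (\<lambda>x. (\<lambda>w. map2 min w (rot 3 w)) (wV n x)) L)"

lemma w_nth:
  assumes "col x < n" "j < n"
  shows "wU n x ! j = pdist n x (U j)" "wV n x ! j = pdist n x (V j)"
  using assms by (cases x; simp add: wU_def wV_def nth_rot_tab pdist_cyc gap_def reach_fun add.commute)+

lemma w_length [simp]: "length (wU n x) = n" "length (wV n x) = n"
  by (simp_all add: wU_def wV_def)

lemma set_pedges: "e \<in> set (pedges n) \<longleftrightarrow> idx e < n"
  by (cases e) (auto simp: pedges_def)

lemma table_eq:
  assumes n: "3 \<le> n" and L: "\<And>x. x \<in> set L \<Longrightarrow> col x < n"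
  shows "table n L = map (\<lambda>e. map (\<lambda>x. pe n x e) L) (pedges n)"
proof -
  have wr: "wrap n (j + 1) < n" "wrap n (j + 3) < n" if "j < n" for j
    using that n by (auto simp: wrap_def)
  have r: "rows n (map f L) = map (\<lambda>e. map (\<lambda>x. pe n x e) L) (map k [0..<n])"
    if "\<And>x. x \<in> set L \<Longrightarrow> length (f x) = n"
      and "\<And>x j. x \<in> set L \<Longrightarrow> j < n \<Longrightarrow> f x ! j = pe n x (k j)" for f k
  proof -
    have l: "length b = n" if "b \<in> set (map f L)" for b using that \<open>\<And>x. x \<in> set L \<Longrightarrow> length (f x) =
        n\<close> by auto
    show ?thesis
      using rows(1)[of "map f L" n, OF l] rows(2)[of "map f L" n, OF l] that(2)
      by (intro nth_equalityI) auto
  qed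
  show ?thesis
    unfolding table_def pedges_def map_append
    by (intro arg_cong2[where f = append] r)
      (use n L wr in \<open>auto simp: w_nth nth_rot dist2_def numeral_3_eq_3\<close>)
qed

section \<open>Comparisons within fibres\<close>

fun select :: "('a \<Rightarrow> nat) \<Rightarrow> nat \<Rightarrow> 'a list \<Rightarrow> 'a list" where
  "select f k [] = []"
| "select f k (x # xs) = (if f x = k then x # select f k xs else select f k xs)"

fun reject :: "('a \<Rightarrow> nat) \<Rightarrow> nat \<Rightarrow> 'a list \<Rightarrow> 'a list" where
  "reject f k [] = []"
| "reject f k (x # xs) = (if f x = k then reject f k xs else x # reject f k xs)"

text \<open>Splitting by \<open>f\<close> avoids comparing elements of different fibres. The
  emptiness test at 0 ensures that no value of \<open>f\<close> reaches the initial bound.\<close>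

fun all_fibres :: "('a list \<Rightarrow> bool) \<Rightarrow> ('a \<Rightarrow> nat) \<Rightarrow> nat \<Rightarrow> 'a list \<Rightarrow> bool" where
  "all_fibres p f 0 xs = List.null xs"
| "all_fibres p f (Suc k) xs = (p (select f k xs) \<and> all_fibres p f k (reject f k xs))"

lemma select_eq: "select f k xs = filter (\<lambda>x. f x = k) xs" and reject_eq: "reject f k xs = filter
    (\<lambda>x. f x \<noteq> k) xs"
  by (induction xs) auto

lemma all_fibres:
  assumes "all_fibres p f b xs"
  shows "k < b \<Longrightarrow> p (filter (\<lambda>x. f x = k) xs)" "x \<in> set xs \<Longrightarrow> f x < b"
proof -
  have "(\<forall>k<b. p (filter (\<lambda>x. f x = k) xs)) \<and> (\<forall>x\<in>set xs. f x < b)"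
    using assms
  proof (induction b arbitrary: xs)
    case 0
    then show ?case by (cases xs) auto
  next
    case (Suc b)
    then have b: "p (filter (\<lambda>x. f x = b) xs)" "all_fibres p f b (filter (\<lambda>x. f x \<noteq> b) xs)"
      by (simp_all add: select_eq reject_eq)
    have "filter (\<lambda>x. f x = k) (filter (\<lambda>x. f x \<noteq> b) xs) = filter (\<lambda>x. f x = k) xs" if "k < b" for k
      unfolding filter_filter using that by (intro filter_cong) auto
    with Suc.IH[OF b(2)] b(1) show ?case by (simp add: less_Suc_eq del: filter_filter) blast
  qed
  then show "k < b \<Longrightarrow> p (filter (\<lambda>x. f x = k) xs)" "x \<in> set xs \<Longrightarrow> f x < b" by auto
qed

text \<open>Equal elements lie in the same fibre.\<close>

lemma distinct_fibres:
  assumes "all_fibres distinct f b xs"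
  shows "distinct xs"
proof -
  have "distinct xs" if "\<forall>k. distinct (filter (\<lambda>x. f x = k) xs)" for xs
    using that
  proof (induction xs)
    case (Cons x xs)
    then have "distinct xs" by (metis distinct.simps(2) filter.simps(2))
    moreover have "distinct (filter (\<lambda>y. f y = f x) (x # xs))" using Cons.prems by blast
    ultimately show ?case by simp
  qed simp
  moreover have "distinct (filter (\<lambda>x. f x = k) xs)" for k
  proof (cases "k < b")
    case False
    then have "filter (\<lambda>x. f x = k) xs = []"
      using all_fibres(2)[OF assms] by (auto simp: filter_empty_conv)
    then show ?thesis by simp
  qed (use all_fibres(1)[OF assms] in blast)
  ultimately show ?thesis by blast
qed

text \<open>The fibres belong to the distance from the first landmark; that it stays below 12 is
  part of the test.\<close>

definition resolving :: "nat \<Rightarrow> pvertex list \<Rightarrow> bool" where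
  "resolving n L \<longleftrightarrow> all_fibres distinct hd 12 (table n L)"

lemma resolving_not_confused:
  assumes "3 \<le> n" "\<And>x. x \<in> set L \<Longrightarrow> col x < n" "resolving n L"
  shows "\<not> confused n (set L)"
proof
  assume "confused n (set L)"
  then obtain e e' where e: "idx e < n" "idx e' < n" "e \<noteq> e'" "\<forall>x\<in>set L. pe n x e = pe n x e'"
    by (auto simp: confused_def)
  have "inj_on (\<lambda>e. map (\<lambda>x. pe n x e) L) (set (pedges n))"
    using assms table_eq[OF assms(1,2)] by (metis distinct_fibres distinct_map resolving_def)
  from inj_onD[OF this, of e e'] e show False by (simp add: set_pedges)
qed

section \<open>Distance vectors differing by a multiple of (1,1,-1,-1)\<close>

fun kind :: "pedge \<Rightarrow> nat" where
  "kind (Sp j) = 0"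
| "kind (Ou j) = 1"
| "kind (In j) = 2"

text \<open>The columns -6..9, read cyclically. The bound 10 is the later insertion column 13 less
  the three columns that \<open>squeeze\<close> removes.\<close>

definition origin_zone :: "nat \<Rightarrow> nat \<Rightarrow> bool" where
  "origin_zone n j \<longleftrightarrow> j < 10 \<or> n \<le> j + 6"

text \<open>Here \<open>h + 10 = h + 16 - 6\<close> is the first squeezed column after the second
  insertion.\<close>

definition antipode_zone :: "nat \<Rightarrow> nat \<Rightarrow> bool" where
  "antipode_zone h j \<longleftrightarrow> h \<le> j + 6 \<and> j < h + 10"

text \<open>
  The conclusion of the upper bound induction for edges \<open>e\<close>, \<open>e'\<close> whose distance vectors differ by
  \<open>d(1,1,-1,-1)\<close> with \<open>d \<ge> 0\<close>.
\<close>

definition aligned_by :: "nat \<Rightarrow> nat \<Rightarrow> pedge \<Rightarrow> pedge \<Rightarrow> nat \<Rightarrow> bool" where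
  "aligned_by n h e e' d \<longleftrightarrow>
     kind e = kind e' \<and>
       (idx e = idx e' + 3 * d \<and> idx e \<le> h + 2 \<or> idx e' = idx e + 3 * d \<and> h + 2 \<le> idx e) \<or>
     0 < d \<and> (origin_zone n (idx e') \<or> antipode_zone h (idx e))"

text \<open>
  The three numbers in the list are invariant under adding \<open>d(1,1,-1,-1)\<close> to the distance vector;
  the summand 4 prevents truncation.
\<close>

fun entry :: "pedge \<Rightarrow> nat list \<Rightarrow> pedge \<times> nat \<times> nat list" where
  "entry e [a1, a2, a3, a4] = (e, a1, [a1 + 4 - a2, a3 + 4 - a4, a1 + a3])"
| "entry e _ = (e, 0, [])"

text \<open>The multiple is read off the first coordinate, and the edges are ordered so that it is
  not negative.\<close>

fun compatible :: "nat \<Rightarrow> nat \<Rightarrow> pedge \<times> nat \<times> nat list \<Rightarrow> pedge \<times> nat \<times> nat list \<Rightarrow> bool" where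
  "compatible n h (e, a, ks) (e', b, ls) =
     (if ks = ls then if b \<le> a then aligned_by n h e e' (a - b) else aligned_by n h e' e (b - a)
         else True)"

definition antipodal :: "nat \<Rightarrow> pvertex list \<Rightarrow> pvertex list" where
  "antipodal h B = map (recol ((+) h)) B"

fun key :: "pedge \<times> nat \<times> nat list \<Rightarrow> nat" where
  "key (e, a, ks) = hd ks"

definition rigid :: "nat \<Rightarrow> nat \<Rightarrow> pvertex list \<Rightarrow> bool" where
  "rigid n h L \<longleftrightarrow> all_fibres (all_pairs (compatible n h)) key 10 (map2 entry (pedges n) (table n L))"

definition tame :: "pvertex list \<Rightarrow> pvertex list \<Rightarrow> nat \<Rightarrow> bool" where
  "tame A B n \<longleftrightarrow> (\<forall>e e' d. idx e < n \<longrightarrow> idx e' < n \<longrightarrow>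
     (\<forall>x\<in>set A. pe n x e = pe n x e' + d) \<longrightarrow> (\<forall>x\<in>set (antipodal (n div 2) B). pe n x e + d = pe n x e') \<longrightarrow>
     aligned_by n (n div 2) e e' d)"

lemma rigid_tame:
  assumes n: "3 \<le> n" and AB: "length A = 2" "length B = 2"
    and L: "\<And>x. x \<in> set (A @ antipodal (n div 2) B) \<Longrightarrow> col x < n"
    and r: "rigid n (n div 2) (A @ antipodal (n div 2) B)"
  shows "tame A B n"
  unfolding tame_def
proof (intro allI impI)
  fix e e' d
  assume e: "idx e < n" "idx e' < n" "\<forall>x\<in>set A. pe n x e = pe n x e' + d"
    "\<forall>x\<in>set (antipodal (n div 2) B). pe n x e + d = pe n x e'"
  obtain a1 a2 where A: "A = [a1, a2]" using AB(1) by (auto simp: length_Suc_conv numeral_2_eq_2)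
  obtain b1 b2 where B: "antipodal (n div 2) B = [b1, b2]" using AB(2) by (auto simp:
      length_Suc_conv numeral_2_eq_2 antipodal_def)
  let ?s = "\<lambda>e. [pe n a1 e, pe n a2 e, pe n b1 e, pe n b2 e]"
  have t: "table n (A @ antipodal (n div 2) B) = map ?s (pedges n)"
    using table_eq[of n "A @ antipodal (n div 2) B", OF n L] by (simp add: A B)
  have z: "map2 entry (pedges n) (map ?s (pedges n)) = map (\<lambda>c. entry c (?s c)) (pedges n)"
    by (simp add: zip_map2 zip_same_conv_map)
  have m: "entry c (?s c) \<in> set (map2 entry (pedges n) (table n (A @ antipodal (n div 2) B)))" if
      "idx c < n" for c
    unfolding t z set_map by (rule imageI) (use that in \<open>simp add: set_pedges\<close>)
  \<comment> \<open>The summand \<open>d\<close> cancels in the first invariant, so both edges land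
    in one fibre.\<close>
  have k: "key (entry e (?s e)) = key (entry e' (?s e'))" using e(3) by (simp add: A)
  define xs where "xs = filter (\<lambda>x. key x = key (entry e (?s e))) (map2 entry (pedges n) (table n
      (A @ antipodal (n div 2) B)))"
  have mem: "entry e (?s e) \<in> set xs" "entry e' (?s e') \<in> set xs"
    using m[OF e(1)] m[OF e(2)] k unfolding xs_def by auto
  have "all_pairs (compatible n (n div 2)) xs"
    unfolding xs_def using all_fibres[OF r[unfolded rigid_def]] m[OF e(1)] by blast
  from all_pairs[OF this mem]
  have "compatible n (n div 2) (entry e (?s e)) (entry e' (?s e')) \<or> compatible n (n div 2) (entry
      e' (?s e')) (entry e (?s e))" .
  \<comment> \<open>The reversed pair yields \<open>aligned_by\<close> with exchanged edges only for
    \<open>d = 0\<close>, where it is symmetric.\<close>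
  then have "aligned_by n (n div 2) e e' d \<or> d = 0 \<and> aligned_by n (n div 2) e' e 0"
    using e(3,4) by (auto simp: A B split: if_splits)
  then show "aligned_by n (n div 2) e e' d"
    by (auto simp: aligned_by_def)
qed

lemma tame_not_confused:
  assumes "tame A B n"
  shows "\<not> confused n (set (A @ antipodal (n div 2) B))"
proof
  assume "confused n (set (A @ antipodal (n div 2) B))"
  then obtain e e' where e: "idx e < n" "idx e' < n" "e \<noteq> e'"
    "\<forall>x\<in>set (A @ antipodal (n div 2) B). pe n x e = pe n x e'"
    by (auto simp: confused_def)
  then have "aligned_by n (n div 2) e e' 0"
    using assms unfolding tame_def by (metis Un_iff add_0_right set_append)
  then show False using e(3) by (cases e; cases e') (auto simp: aligned_by_def)
qed


section \<open>The insertion as seen from the landmarks\<close>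

fun reidx :: "(nat \<Rightarrow> nat) \<Rightarrow> pedge \<Rightarrow> pedge" where
  "reidx f (Sp j) = Sp (f j)"
| "reidx f (Ou j) = Ou (f j)"
| "reidx f (In j) = In (f j)"

lemma idx_reidx: "idx (reidx f e) = f (idx e)" and kind_reidx: "kind (reidx f e) = kind e"
  by (cases e; simp)+

text \<open>Here \<open>v\<close> is the endpoint at offset \<open>i\<close> of an edge with index
  \<open>j\<close>. Squeezing \<open>j\<close> instead of the endpoints keeps edges across an
  insertion intact; near endpoints then reach column \<open>12 + 3 = 15\<close>, and gaps of 15
  again need 38 columns.\<close>

lemma pdist_squeeze_edge:
  assumes n: "38 \<le> n" and h: "h = n div 2" and j: "j < n + 6" "i \<le> 3"
    and v: "reach y v = reach y v'" "col v = wrap (n + 6) (j + i)" "col v' = wrap n (squeeze 13 (h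
        + 13) j + i)"
  shows "col y \<le> 4 \<Longrightarrow> pdist (n + 6) y v = pdist n y v' + (if 13 \<le> j \<and> j < h + 16 then 1 else 0)"
    "col y \<le> 5 \<Longrightarrow> pdist (n + 6) (recol ((+) (h + 3)) y) v = pdist n (recol ((+) h) y) v' +
      (if 13 \<le> j \<and> j < h + 16 then 0 else 1)"
proof -
  have id: "recol (\<lambda>c. c) w = w" for w by (cases w) auto
  have r: "reach (recol ((+) (h + 3)) y) v = reach (recol ((+) h) y) v'"
    using v(1) reach_recol[of "(+) (h + 3)" y "\<lambda>c. c" v] reach_recol[of "(+) h" y "\<lambda>c. c" v']
    by (simp add: id)
  have h2: "2 * h \<le> n" "n \<le> 2 * h + 1" using h by auto
  have cv: "col v = (if j + i < n + 6 then j + i else j + i - (n + 6))" using v(2) by (simp add: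
      wrap_def)
  consider "j < 13" | "13 \<le> j" "j < h + 16" | "h + 16 \<le> j" "j + i < n + 6" | "h + 16 \<le> j" "n + 6 \<le>
      j + i"
    by linarith
  note cases = this
  have c1: "col v' = j + i" "col v = j + i" if "j < 13"
    using that j n v(2,3) by (simp_all add: squeeze_def wrap_def)
  have c2: "col v' + 3 = j + i" "col v = j + i" if "13 \<le> j" "j < h + 16"
    using that j n h2 v(2,3) by (simp_all add: squeeze_def wrap_def)
  have c3: "col v' + 6 = j + i" "col v = j + i" if "h + 16 \<le> j" "j + i < n + 6"
    using that j n h2 v(2,3) by (simp_all add: squeeze_def wrap_def)
  \<comment> \<open>An endpoint past the last column wraps to the same column, one of 0..2, in both
    graphs.\<close>
  have c4: "col v' + (n + 6) = j + i" "col v + (n + 6) = j + i" "col v' = col v" "col v \<le> 2"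
    if jj: "h + 16 \<le> j" "n + 6 \<le> j + i"
  proof -
    obtain r where r: "j + i = n + 6 + r" using jj(2) le_Suc_ex by blast
    have "squeeze 13 (h + 13) j + i = n + r" using jj r j n h2 by (simp add: squeeze_def)
    then have "col v' = r" using v(3) by (simp add: wrap_def)
    moreover have "col v = r" using cv r by simp
    moreover have "r \<le> 2" using r j by linarith
    ultimately show "col v' + (n + 6) = j + i" "col v + (n + 6) = j + i" "col v' = col v" "col v \<le> 2"
      using r by simp_all
  qed
  show "pdist (n + 6) y v = pdist n y v' + (if 13 \<le> j \<and> j < h + 16 then 1 else 0)" if y: "col y \<le> 4"
    using cases
  proof cases
    case 1
    then have "pdist (n + 6) y v = pdist n y v'"
      using n j y c1 by (intro pdist_near v) (simp_all add: gap_def)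
    with 1 show ?thesis by simp
  next
    case 2
    then have "pdist (n + 6) y v = Suc (pdist n y v')"
      using n j y h2 c2 by (intro pdist_far v) (simp_all add: gap_def)
    with 2 show ?thesis by simp
  next
    case 3
    then have "pdist (n + 6) y v = pdist n y v'"
      using n j y h2 c3 by (intro pdist_wrap v) (simp_all add: gap_def)
    with 3 show ?thesis by simp
  next
    case 4
    then have "pdist (n + 6) y v = pdist n y v'"
      using n j y h2 c4 by (intro pdist_near v) (simp_all add: gap_def)
    with 4 show ?thesis by simp
  qed
  show "pdist (n + 6) (recol ((+) (h + 3)) y) v = pdist n (recol ((+) h) y) v' +
      (if 13 \<le> j \<and> j < h + 16 then 0 else 1)" if y: "col y \<le> 5"
    using cases
  proof cases
    case 1
    then have "pdist (n + 6) (recol ((+) (h + 3)) y) v = Suc (pdist n (recol ((+) h) y) v')"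
      using n j y h2 c1 by (intro pdist_far r) (simp_all add: gap_def col_recol)
    with 1 show ?thesis by simp
  next
    case 2
    then have "pdist (n + 6) (recol ((+) (h + 3)) y) v = pdist n (recol ((+) h) y) v'"
      using n j y h2 c2 by (intro pdist_near r) (auto simp: gap_def col_recol)
    with 2 show ?thesis by simp
  next
    case 3
    then have "pdist (n + 6) (recol ((+) (h + 3)) y) v = Suc (pdist n (recol ((+) h) y) v')"
      using n j y h2 c3 by (intro pdist_far r) (simp_all add: gap_def col_recol)
    with 3 show ?thesis by simp
  next
    case 4
    then have "pdist (n + 6) (recol ((+) (h + 3)) y) v = Suc (pdist n (recol ((+) h) y) v')"
      using n j y h2 c4 by (intro pdist_far r) (simp_all add: gap_def col_recol)
    with 4 show ?thesis by simp
  qed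
qed

lemma pe_squeeze_edge:
  assumes n: "38 \<le> n" and h: "h = n div 2" and e: "idx e < n + 6"
  defines "e' \<equiv> reidx (squeeze 13 (h + 13)) e"
  shows "col y \<le> 4 \<Longrightarrow> pe (n + 6) y e = pe n y e' + (if 13 \<le> idx e \<and> idx e < h + 16 then 1 else 0)"
    "col y \<le> 5 \<Longrightarrow> pe (n + 6) (recol ((+) (h + 3)) y) e = pe n (recol ((+) h) y) e' +
      (if 13 \<le> idx e \<and> idx e < h + 16 then 0 else 1)"
proof -
  have w: "wrap (n + 6) (idx e) = idx e" "wrap n (squeeze 13 (h + 13) (idx e)) = squeeze 13 (h +
      13) (idx e)"
    using e n h by (auto simp: wrap_def squeeze_def)
  have "\<exists>i\<le>3. reach y (fst (ends (n + 6) e)) = reach y (fst (ends n e')) \<and>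
      col (fst (ends (n + 6) e)) = wrap (n + 6) (idx e + i) \<and>
      col (fst (ends n e')) = wrap n (squeeze 13 (h + 13) (idx e) + i)"
    by (rule exI[of _ 0]) (use w in \<open>cases e; cases y; simp add: e'_def reach_fun\<close>)
  then obtain i where i: "i \<le> 3" "reach y (fst (ends (n + 6) e)) = reach y (fst (ends n e'))"
      "col (fst (ends (n + 6) e)) = wrap (n + 6) (idx e + i)"
      "col (fst (ends n e')) = wrap n (squeeze 13 (h + 13) (idx e) + i)" by blast
  have "\<exists>k\<le>3. reach y (snd (ends (n + 6) e)) = reach y (snd (ends n e')) \<and>
      col (snd (ends (n + 6) e)) = wrap (n + 6) (idx e + k) \<and>
      col (snd (ends n e')) = wrap n (squeeze 13 (h + 13) (idx e) + k)"
    by (rule exI[of _ "case e of Sp _ \<Rightarrow> 0 | Ou _ \<Rightarrow> 1 | In _ \<Rightarrow> 3"])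
      (use w in \<open>cases e; cases y; simp add: e'_def reach_fun numeral_3_eq_3\<close>)
  then obtain k where k: "k \<le> 3" "reach y (snd (ends (n + 6) e)) = reach y (snd (ends n e'))"
      "col (snd (ends (n + 6) e)) = wrap (n + 6) (idx e + k)"
      "col (snd (ends n e')) = wrap n (squeeze 13 (h + 13) (idx e) + k)" by blast
  note p = pdist_squeeze_edge[OF n h e i] pdist_squeeze_edge[OF n h e k]
  show "col y \<le> 4 \<Longrightarrow> pe (n + 6) y e = pe n y e' + (if 13 \<le> idx e \<and> idx e < h + 16 then 1 else 0)"
    "col y \<le> 5 \<Longrightarrow> pe (n + 6) (recol ((+) (h + 3)) y) e = pe n (recol ((+) h) y) e' +
      (if 13 \<le> idx e \<and> idx e < h + 16 then 0 else 1)"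
    using p by (simp_all add: dist2_def)
qed

text \<open>The insertion adds \<open>s e\<close> to the distances from \<open>A\<close> and
  \<open>1 - s e\<close> to those from the antipodal landmarks. So the squeezed edges differ by the
  multiple \<open>d + s e' - s e\<close> of (1,1,-1,-1).\<close>

lemma tame_step:
  assumes n: "38 \<le> n" and A: "\<forall>x\<in>set A. col x \<le> 4" and B: "\<forall>x\<in>set B. col x \<le> 5"
    and t: "tame A B n"
  shows "tame A B (n + 6)"
proof -
  define h where "h = n div 2"
  have h3: "(n + 6) div 2 = h + 3" by (simp add: h_def)
  have h2: "2 * h \<le> n" "n \<le> 2 * h + 1" by (auto simp: h_def)
  let ?k = "reidx (squeeze 13 (h + 13))"
  define s :: "pedge \<Rightarrow> nat" where "s e = (if 13 \<le> idx e \<and> idx e < h + 16 then 1 else 0)" for e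
  have pA: "pe (n + 6) x e = pe n x (?k e) + s e" if "x \<in> set A" "idx e < n + 6" for x e
    using pe_squeeze_edge(1)[OF n h_def that(2)] A that(1) by (simp add: s_def)
  have pB: "pe (n + 6) (recol ((+) (h + 3)) x) e = pe n (recol ((+) h) x) (?k e) + (1 - s e)"
    if "x \<in> set B" "idx e < n + 6" for x e
    using pe_squeeze_edge(2)[OF n h_def that(2)] B that(1) by (simp add: s_def)
  have k: "idx (?k e) < n" if "idx e < n + 6" for e
    using that n h2 by (auto simp: idx_reidx squeeze_def)
  show ?thesis
    unfolding tame_def h3
  proof (intro allI impI)
    fix e e' d
    assume e: "idx e < n + 6" "idx e' < n + 6" "\<forall>x\<in>set A. pe (n + 6) x e = pe (n + 6) x e' + d"
      "\<forall>x\<in>set (antipodal (h + 3) B). pe (n + 6) x e + d = pe (n + 6) x e'"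
    have a: "pe n x (?k e) + s e = pe n x (?k e') + s e' + d" if "x \<in> set A" for x
    proof -
      have "pe (n + 6) x e = pe (n + 6) x e' + d" using e(3) that by blast
      then show ?thesis using pA[OF that e(1)] pA[OF that e(2)] by linarith
    qed
    have b: "pe n x (?k e) + (1 - s e) + d = pe n x (?k e') + (1 - s e')" if x: "x \<in> set (antipodal
        h B)" for x
    proof -
      obtain y where y: "y \<in> set B" "x = recol ((+) h) y" using x by (auto simp: antipodal_def)
      then have "pe (n + 6) (recol ((+) (h + 3)) y) e + d = pe (n + 6) (recol ((+) (h + 3)) y) e'"
        using e(4) unfolding antipodal_def set_map by blast
      then show ?thesis unfolding y(2) using pB[OF y(1) e(1)] pB[OF y(1) e(2)] by linarith
    qed
    have s01: "s e \<le> 1" "s e' \<le> 1" by (simp_all add: s_def)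
    show "aligned_by (n + 6) (h + 3) e e' d"
    proof (cases "s e \<le> s e' + d")
      case True
      define d0 where "d0 = s e' + d - s e"
      have "aligned_by n h (?k e) (?k e') d0"
      proof -
        have "\<forall>x\<in>set A. pe n x (?k e) = pe n x (?k e') + d0" using a True unfolding d0_def by fastforce
        moreover have "\<forall>x\<in>set (antipodal h B). pe n x (?k e) + d0 = pe n x (?k e')"
        proof
          fix x assume "x \<in> set (antipodal h B)"
          then show "pe n x (?k e) + d0 = pe n x (?k e')" using b[of x] True s01 unfolding d0_def
              by linarith
        qed
        ultimately show ?thesis using t k e(1,2) unfolding tame_def h_def[symmetric] by blast
      qed
      \<comment> \<open>Undoing the squeeze moves an edge by \<open>3 * s\<close> columns on the arc
        up to \<open>h + 2\<close> and by \<open>6 - 3 * s\<close> on the other, so a shift by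
        \<open>3 * d0\<close> becomes one by \<open>3 * d\<close>. The origin zone forces
        \<open>s e' = 0\<close> and the antipode zone \<open>s e = 1\<close>, so
        \<open>d0 > 0\<close> gives \<open>d > 0\<close>.\<close>
      then show ?thesis
        using True n h2 e(1,2)
        by (auto simp: aligned_by_def d0_def s_def idx_reidx kind_reidx squeeze_def origin_zone_def
            antipode_zone_def split: if_splits)
    next
      case False
      then have d: "d = 0" "s e = 1" "s e' = 0" using s01 by auto
      \<comment> \<open>The multiple would be -1, so the edges are exchanged.\<close>
      have "aligned_by n h (?k e') (?k e) 1"
      proof -
        have "\<forall>x\<in>set A. pe n x (?k e') = pe n x (?k e) + 1" using a d by simp
        moreover have "\<forall>x\<in>set (antipodal h B). pe n x (?k e') + 1 = pe n x (?k e)" using b d by simp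
        ultimately show ?thesis using t k e(1,2) unfolding tame_def h_def[symmetric] by blast
      qed
      moreover have ie: "13 \<le> idx e" "idx e < h + 16" using d by (auto simp: s_def split: if_splits)
      moreover have "idx (?k e) = idx e - 3" using ie by (simp add: idx_reidx squeeze_def)
      moreover have "idx e' < 13 \<and> idx (?k e') = idx e' \<or> h + 16 \<le> idx e' \<and> idx (?k e') = idx e' - 6"
        using d by (auto simp: s_def idx_reidx squeeze_def split: if_splits)
      \<comment> \<open>The squeezed \<open>e\<close> lies in columns 10 to \<open>h + 12\<close>,
        the squeezed \<open>e'\<close> below 13 or from \<open>h + 10\<close> on. This rules out
        both zones and an alignment by three columns.\<close>
      ultimately have False
        using n h2 unfolding aligned_by_def origin_zone_def antipode_zone_def by linarith
      then show ?thesis ..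
    qed
  qed
qed

section \<open>Finite computations\<close>

text \<open>
  The pairs were found by a computer search. Column numbers in the far lists, and of the second
  edges in the mixed lists, are relative to column \<open>n div 2\<close>.
\<close>

definition nearV :: "(pedge \<times> pedge) list" where
  "nearV =
    [(Ou 2, Sp 3), (Ou 5, Sp 5), (Ou 2, Ou 1), (Ou 6, Ou 5), (Ou 4, Ou 3), (In 3, In 0),
     (Ou 6, Ou 1), (In 5, In 2), (In 4, In 1), (Ou 5, Ou 0), (Ou 7, Ou 2), (Ou 1, Ou 0),
     (Ou 7, Ou 6)]"

definition farV :: "(pedge \<times> pedge) list" where
  "farV =
    [(Ou 4, Ou 3), (Ou 7, Sp 5), (In 0, Sp 0), (In 5, Sp 8), (In 5, Sp 5), (Ou 1, Sp 4),
     (Sp 7, Sp 2), (In 1, Sp 4), (In 0, Sp 3), (Ou 2, Sp 5), (Ou 6, Ou 5), (Ou 3, Ou 2),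
     (Ou 7, Ou 6), (Ou 5, Ou 4), (Ou 2, Ou 1), (In 4, In 2)]"

definition nearU :: "(pedge \<times> pedge) list" where
  "nearU =
    [(In 5, In 3), (Ou 2, Sp 3), (Ou 5, Sp 5), (Ou 6, Sp 6), (Ou 3, Sp 4), (Ou 1, Sp 2),
     (Ou 4, Sp 4), (Sp 6, Sp 2), (In 2, In 0), (In 2, Sp 7), (Ou 7, Sp 8), (Ou 1, Sp 6)]"

definition farU :: "(pedge \<times> pedge) list" where
  "farU =
    [(In 5, Sp 8), (In 1, Sp 1), (Sp 5, Sp 3), (Ou 1, Sp 1)]"

definition nearV_small :: "(pedge \<times> pedge) list" where
  "nearV_small =
    [(Ou 6, Ou 5), (Ou 2, Ou 1), (Ou 4, Ou 3), (Ou 2, Sp 3), (Ou 1, Ou 0), (Ou 5, Sp 5),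
     (Ou 7, Ou 6), (In 5, In 3), (Ou 8, Sp 8), (In 4, In 1), (In 3, In 0), (In 5, In 2),
     (In 2, In 0), (In 4, Sp 4), (Ou 5, Sp 10), (Ou 9, Ou 8), (In 5, In 0), (In 0, Ou 8)]"

definition farV_small :: "(pedge \<times> pedge) list" where
  "farV_small =
    [(Ou 3, Ou 2), (Ou 5, Ou 4), (Ou 4, Ou 3), (In 4, In 2), (Ou 6, Ou 5), (Ou 2, Ou 1),
     (Ou 7, Ou 6), (In 1, Sp 4), (In 5, In 1), (Ou 7, Sp 5), (In 5, Sp 5), (In 4, In 1),
     (Ou 1, Sp 4), (Sp 7, Sp 2), (Ou 2, Sp 0), (Ou 5, Sp 6)]"

definition mixedV_small :: "(pedge \<times> pedge) list" where
  "mixedV_small =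
    [(Ou 10, Sp 4), (Sp 0, Ou 7), (Sp 0, Ou 6), (Ou 6, Ou 9), (Sp 9, Ou 0), (In 2, Ou 2),
     (Ou 7, Ou 10), (Sp 8, In 7), (Ou 8, Ou 5), (In 5, Sp 7)]"

definition nearU_small :: "(pedge \<times> pedge) list" where
  "nearU_small =
    [(In 8, In 6), (In 7, In 5), (Ou 7, Sp 8), (Ou 4, Sp 4), (Ou 8, Sp 9), (In 2, In 0),
     (Ou 6, Sp 7), (Ou 9, Sp 9), (Ou 1, Sp 1), (Ou 6, Sp 6), (Ou 2, Sp 3), (In 10, Sp 8)]"

definition farU_small :: "(pedge \<times> pedge) list" where
  "farU_small =
    [(In 4, In 2)]"

definition mixedU_small :: "(pedge \<times> pedge) list" where
  "mixedU_small =
    [(Ou 10, Sp 2), (In 10, In 6), (In 9, Sp 8)]"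

text \<open>
  The second list holds the landmarks near the antipode, before translation by \<open>n div 2\<close>.
\<close>

definition near_landmarks :: "nat \<Rightarrow> pvertex list" where
  "near_landmarks n = (if n mod 6 \<le> 2 then [V 0, U 4] else if n mod 6 \<le> 4 then [U 0, V 1] else [U
      0, U 4])"

definition far_landmarks :: "nat \<Rightarrow> pvertex list" where
  "far_landmarks n = (if n mod 6 \<le> 2 then [V 0, U 1] else if n mod 6 \<le> 4 then [V 2, U 3] else [U 2,
      U 3])"

definition resolving_check :: "nat \<Rightarrow> nat \<Rightarrow> bool" where
  "resolving_check n h = resolving n (near_landmarks n @ antipodal h (far_landmarks n))"

definition rigid_check :: "nat \<Rightarrow> nat \<Rightarrow> bool" where
  "rigid_check n h = rigid n h (near_landmarks n @ antipodal h (far_landmarks n))"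

definition covers :: "nat \<Rightarrow> (pedge \<times> pedge) list \<Rightarrow> (pedge \<times> pedge) list \<Rightarrow> bool" where
  "covers n P Q = (valid n P \<and> coversU n P \<and> valid n Q \<and> coversV n Q)"

definition large_check :: "nat \<Rightarrow> nat \<Rightarrow> bool" where
  "large_check n h = covers n (candidates n h nearU farU []) (candidates n h nearV farV [])"

definition small_check :: "nat \<Rightarrow> nat \<Rightarrow> bool" where
  "small_check n h = covers n (candidates n h nearU_small farU_small mixedU_small) (candidates n h
      nearV_small farV_small mixedV_small)"

definition halves :: "nat \<Rightarrow> nat \<Rightarrow> (nat \<times> nat) list" where
  "halves i j = map (\<lambda>n. (n, n div 2)) [i..<j]"

text \<open>The range 38..43, a full period modulo 6, starts the induction for the upper
  bound.\<close>

lemma rigid_38: "list_all (case_prod rigid_check) (halves 38 40)" by code_simp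
lemma rigid_40: "list_all (case_prod rigid_check) (halves 40 42)" by code_simp
lemma rigid_42: "list_all (case_prod rigid_check) (halves 42 44)" by code_simp

text \<open>Below 38 no induction starts, so the landmarks are tested directly.\<close>

lemma resolving_11: "list_all (case_prod resolving_check) (halves 11 26)" by code_simp
lemma resolving_26: "list_all (case_prod resolving_check) (halves 26 33)" by code_simp
lemma resolving_33: "list_all (case_prod resolving_check) (halves 33 38)" by code_simp

text \<open>Below 22 separate lists are used, which reach beyond column 8 and contain mixed
  pairs.\<close>

lemma small_11: "list_all (case_prod small_check) (halves 11 22)" by code_simp

text \<open>The same lists settle 22..37 directly and serve as base 38..43 of the lower bound
  induction.\<close>

lemma large_22: "list_all (case_prod large_check) (halves 22 28)" by code_simp
lemma large_28: "list_all (case_prod large_check) (halves 28 33)" by code_simp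
lemma large_33: "list_all (case_prod large_check) (halves 33 37)" by code_simp
lemma large_37: "list_all (case_prod large_check) (halves 37 41)" by code_simp
lemma large_41: "list_all (case_prod large_check) (halves 41 44)" by code_simp

lemma narrow_pairs: "narrow nearU" "narrow farU" "narrow nearV" "narrow farV"
  by code_simp+

section \<open>The edge dimension\<close>

lemma halvesD:
  assumes "list_all (case_prod p) (halves i j)" "i \<le> n" "n < j"
  shows "p n (n div 2)"
  using assms by (auto simp: halves_def list_all_iff)

lemma resolving_check:
  assumes "11 \<le> n" "n < 38"
  shows "resolving_check n (n div 2)"
  using assms halvesD[OF resolving_11, of n] halvesD[OF resolving_26, of n] halvesD[OF
      resolving_33, of n]
  by linarith

lemma large_check:
  assumes "22 \<le> n" "n < 44"
  shows "large_check n (n div 2)"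
  using assms halvesD[OF large_22, of n] halvesD[OF large_28, of n] halvesD[OF large_33, of n]
    halvesD[OF large_37, of n] halvesD[OF large_41, of n]
  by linarith

lemma rigid_check:
  assumes "38 \<le> n" "n < 44"
  shows "rigid_check n (n div 2)"
  using assms halvesD[OF rigid_38, of n] halvesD[OF rigid_40, of n] halvesD[OF rigid_42, of n]
  by linarith

lemma landmarks:
  assumes "11 \<le> n"
  shows "distinct (near_landmarks n @ antipodal (n div 2) (far_landmarks n))" "length
      (near_landmarks n @ antipodal (n div 2) (far_landmarks n)) = 4"
    "\<And>x. x \<in> set (near_landmarks n @ antipodal (n div 2) (far_landmarks n)) \<Longrightarrow> col x < n"
    "length (near_landmarks n) = 2" "length (far_landmarks n) = 2" "\<forall>x\<in>set (near_landmarks n). col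
        x \<le> 4" "\<forall>x\<in>set (far_landmarks n). col x \<le> 5"
proof -
  have h: "5 \<le> n div 2" "n div 2 + 5 < n" using assms by linarith+
  then show "distinct (near_landmarks n @ antipodal (n div 2) (far_landmarks n))" by (simp add:
      near_landmarks_def far_landmarks_def antipodal_def)
  show "col x < n" if "x \<in> set (near_landmarks n @ antipodal (n div 2) (far_landmarks n))" for x
    using that h by (auto simp: near_landmarks_def far_landmarks_def antipodal_def split: if_splits)
qed (auto simp: near_landmarks_def far_landmarks_def antipodal_def)

lemma landmarks_resolve:
  assumes n: "11 \<le> n"
  shows "\<not> confused n (set (near_landmarks n @ antipodal (n div 2) (far_landmarks n)))"
proof (cases "n < 38")
  case True
  then show ?thesis
    using resolving_check[OF n] landmarks(3)[OF n] n unfolding resolving_check_def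
    by (intro resolving_not_confused) auto
next
  case False
  have "tame (near_landmarks n) (far_landmarks n) n"
  proof (rule nat_induct_step_6[where m = 38])
    fix m :: nat assume "m \<in> {38..<38 + 6}"
    then show "tame (near_landmarks m) (far_landmarks m) m"
      using rigid_check[of m] landmarks(3-5)[of m] unfolding rigid_check_def by (intro rigid_tame) auto
  next
    fix m :: nat assume "38 \<le> m" "tame (near_landmarks m) (far_landmarks m) m"
    \<comment> \<open>The landmarks depend on \<open>n mod 6\<close> only, hence the step 6 keeps
      them.\<close>
    moreover have "near_landmarks (m + 6) = near_landmarks m" "far_landmarks (m + 6) =
        far_landmarks m" by (simp_all add: near_landmarks_def far_landmarks_def)
    ultimately show "tame (near_landmarks (m + 6)) (far_landmarks (m + 6)) (m + 6)"
      using landmarks(6,7)[of m] tame_step[of m "near_landmarks m" "far_landmarks m"] by simp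
  qed (use False in simp)
  then show ?thesis by (rule tame_not_confused)
qed

lemma narrow_valid:
  assumes "38 \<le> n" "narrow near" "narrow far"
  shows "valid n (candidates n (n div 2) near far [])"
proof -
  have "idx e < n \<and> wrap n (idx e + n div 2) < n" if "hi e \<le> 8" for e
    using that assms(1) by (cases e) (auto simp: wrap_def)
  then show ?thesis
    using assms(2,3) by (fastforce simp: valid_def narrow_def list_all_iff candidates_def idx_turn)
qed

lemma candidates_neq: "q \<in> set (candidates n h near far mixed) \<Longrightarrow> fst q \<noteq> snd q"
  by (auto simp: candidates_def)

lemma covered_confused:
  assumes n: "11 \<le> n"
    and P: "valid n P" "\<And>q. q \<in> set P \<Longrightarrow> fst q \<noteq> snd q" "covered (\<lambda>x. \<exists>i. x = U i) (U 4) (\<lambda>_. P) n"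
    and Q: "valid n Q" "\<And>q. q \<in> set Q \<Longrightarrow> fst q \<noteq> snd q" "covered (\<lambda>_. True) (V 4) (\<lambda>_. Q) n"
    and abc: "a \<in> verts (gen_petersen n 3)" "b \<in> verts (gen_petersen n 3)" "c \<in> verts (gen_petersen
        n 3)"
  shows "confused n {a, b, c}"
proof (rule confused_three[OF n _ _ abc])
  have c: "confused n {x, y, z}"
    if "valid n R" "q \<in> set R" "fst q \<noteq> snd q" "same n q x" "same n q y" "same n q z" for R q x y z
    using that unfolding confused_def same_def valid_def list_all_iff
    by (intro exI[of _ "fst q"] exI[of _ "snd q"]) auto
  show "confused n {V 4, y, z}" if "y \<in> verts (gen_petersen n 3)" "z \<in> verts (gen_petersen n 3)" for y z
    using Q(3) that c[OF Q(1) _ Q(2)] unfolding covered_def by blast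
  show "confused n {U 4, U i, U j}" if "i < n" "j < n" for i j
  proof -
    have "U i \<in> verts (gen_petersen n 3)" "U j \<in> verts (gen_petersen n 3)"
      using that by (auto simp: verts_gen_petersen)
    then show ?thesis using P(3) c[OF P(1) _ P(2)] unfolding covered_def by blast
  qed
qed

lemma covers_covered:
  assumes "5 \<le> n" "covers n P Q"
  shows "valid n P" "covered (\<lambda>x. \<exists>i. x = U i) (U 4) (\<lambda>_. P) n" "valid n Q" "covered (\<lambda>_. True) (V
      4) (\<lambda>_. Q) n"
  using assms coversU[of n P] coversV[of n Q]
  by (auto simp: covers_def covered_def verts_gen_petersen)

lemma covered_large:
  assumes "38 \<le> n"
  shows "covered (\<lambda>x. \<exists>i. x = U i) (U 4) (\<lambda>n. candidates n (n div 2) nearU farU []) n"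
    "covered (\<lambda>_. True) (V 4) (\<lambda>n. candidates n (n div 2) nearV farV []) n"
proof -
  \<comment> \<open>Moving columns preserves the type of a vertex, as \<open>covered_step\<close>
    requires of \<open>T\<close>.\<close>
  have U: "(\<exists>i. recol f v = U i) = (\<exists>i. v = U i)" for f v by (cases v) auto
  have base: "covered (\<lambda>x. \<exists>i. x = U i) (U 4) (\<lambda>n. candidates n (n div 2) nearU farU []) m"
    "covered (\<lambda>_. True) (V 4) (\<lambda>n. candidates n (n div 2) nearV farV []) m" if "m \<in> {38..<38 + 6}" for m
    using covers_covered(2,4)[of m] large_check[of m] that by (auto simp: large_check_def covered_def)
  show "covered (\<lambda>x. \<exists>i. x = U i) (U 4) (\<lambda>n. candidates n (n div 2) nearU farU []) n"
    by (rule nat_induct_step_6[OF base(1) _ assms]) (auto intro!: covered_step narrow_pairs U)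
  show "covered (\<lambda>_. True) (V 4) (\<lambda>n. candidates n (n div 2) nearV farV []) n"
    by (rule nat_induct_step_6[OF base(2) _ assms]) (auto intro!: covered_step narrow_pairs)
qed

lemma three_confused:
  assumes n: "11 \<le> n"
    and abc: "a \<in> verts (gen_petersen n 3)" "b \<in> verts (gen_petersen n 3)" "c \<in> verts (gen_petersen
        n 3)"
  shows "confused n {a, b, c}"
proof -
  consider "n < 22" | "22 \<le> n" "n < 38" | "38 \<le> n" by linarith
  then show ?thesis
  proof cases
    case 1
    then have "small_check n (n div 2)" using n halvesD[OF small_11] by blast
    from covers_covered[OF _ this[unfolded small_check_def]] n show ?thesis
      by (intro covered_confused[OF n _ candidates_neq _ _ candidates_neq _ abc]) auto
  next
    case 2
    then have "large_check n (n div 2)" by (intro large_check) auto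
    from covers_covered[OF _ this[unfolded large_check_def]] n show ?thesis
      by (intro covered_confused[OF n _ candidates_neq _ _ candidates_neq _ abc]) auto
  next
    case 3
    from covered_large[OF 3] narrow_valid[OF 3 narrow_pairs(1,2)] narrow_valid[OF 3
        narrow_pairs(3,4)] show ?thesis
      by (intro covered_confused[OF n _ candidates_neq _ _ candidates_neq _ abc]) (auto simp:
          covered_def)
  qed
qed

theorem theorem1p1:
  fixes n :: nat
  assumes "n \<ge> 11"
  shows "edge_dim (gen_petersen n 3) = 4"
proof (rule edge_dim_eq_4I)
  let ?L = "near_landmarks n @ antipodal (n div 2) (far_landmarks n)"
  have "x \<in> verts (gen_petersen n 3)" if "x \<in> set ?L" for x
    using landmarks(3)[OF assms that] by (cases x) (auto simp: verts_gen_petersen)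
  then show "set ?L \<subseteq> verts (gen_petersen n 3)" by blast
  show "card (set ?L) = 4" using distinct_card[OF landmarks(1)[OF assms]] landmarks(2)[OF assms] by simp
  show "\<not> confused n (set ?L)" by (rule landmarks_resolve[OF assms])
qed (use assms three_confused in auto)

end
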